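(* Let $r\ge0$ be an integer and let $f\in C^{2r+4}([0,+\infty))$ be a function with $D^{2r+4}f$ bounded on $[0,+\infty)$. Then, for all $x\ge 0$, as $n\to\infty$, $$\lim n^{r+1}\bigl(f(x)-\mathcal{V}_n^{(2r)}f(x)\bigr)=\bar\eta_{2r+1}(x)\,D^{2r+1}f(x)+\bar\eta_{2r+2}(x)\,D^{2r+2}f(x),$$ $$\lim n^{r+1}\bigl(f(x)-\mathcal{V}_n^{(2r+1)}f(x)\bigr)=\bar\eta_{2r+2}(x)\,D^{2r+2}f(x),$$ where $\mathcal{V}_n^{(s)}$ denotes the left Baskakov quasi-interpolant of order $s$ and, with $X=x(1+x)$, $$\bar\eta_{2r+1}(x)=\frac{(-1)^{r+1}}{3\cdot 2^{r-1}(r-1)!}(1+2x)X^{r},\qquad \bar\eta_{2r+2}(x)=\frac{(-1)^{r+1}}{2^{r+1}(r+1)!}X^{r+1}$$ (with the convention $\frac{1}{(-1)!}=0$, so that $\bar\eta_1=0$).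
   Context: $D=d/dx$, and $\mathbb{P}$ is the space of real polynomials in one variable. For an integer $n\ge1$ the Baskakov operator is $$\mathcal{V}_nf(x)=\sum_{k\ge 0} f\left(\tfrac kn\right) v_{k,n}(x),\qquad v_{k,n}(x)=\binom{n+k-1}{k}x^k(1+x)^{-(n+k)},\quad x\ge 0.$$ On $\mathbb{P}$ it is a degree-preserving linear isomorphism; explicitly, it maps $\prod_{i=0}^{r-1}(x-\frac in)$ to $\frac{n(n+1)\cdots(n+r-1)}{n^r}x^r$. Every linear operator on $\mathbb{P}$ can be written uniquely as $\sum_{k\ge0}a_k(x)D^k$ with polynomial coefficients $a_k$ (the sum is finite when applied to any given polynomial). Let $\eta_k^{(n)}$ be the polynomial coefficients of the inverse: $\mathcal{V}_n^{-1}=\sum_{k\ge0}\eta_k^{(n)}D^k$ on $\mathbb{P}$. The left Baskakov quasi-interpolant of order $s\ge0$ is $$\mathcal{V}_n^{(s)}f(x)=\sum_{k=0}^{s}\eta_k^{(n)}(x)\,D^k(\mathcal{V}_nf)(x),$$ defined for functions $f$ on $[0,+\infty)$ for which the series converge (e.g. functions of at most polynomial growth). *)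

theory Defs
  imports "HOL-Analysis.Analysis" "HOL-Computational_Algebra.Polynomial"
begin

(* Derivative on the half-line: two-sided for x > 0, right-sided at x = 0.  It depends only on the
   values of f on {0..}; its value for x < 0 is irrelevant. *)
definition D :: "(real \<Rightarrow> real) \<Rightarrow> real \<Rightarrow> real" where
  "D f = (\<lambda>x. vector_derivative f (at x within {0..}))"

definition C_half_line :: "nat \<Rightarrow> (real \<Rightarrow> real) set" where
  "C_half_line m =
     {f. (\<forall>k<m. (D ^^ k) f differentiable_on {0..}) \<and> continuous_on {0..} ((D ^^ m) f)}"

definition baskakov_basis :: "nat \<Rightarrow> nat \<Rightarrow> real \<Rightarrow> real" where
  "baskakov_basis n k x = real ((n + k - 1) choose k) * x ^ k / (1 + x) ^ (n + k)"

definition baskakov :: "nat \<Rightarrow> (real \<Rightarrow> real) \<Rightarrow> real \<Rightarrow> real" where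
  "baskakov n f x = (\<Sum>k. f (real k / real n) * baskakov_basis n k x)"

(* The operator on the space of real polynomials; q is unique because a polynomial is determined
   by its values on {0..}. *)
definition baskakov_poly :: "nat \<Rightarrow> real poly \<Rightarrow> real poly" where
  "baskakov_poly n p = (THE q. \<forall>x\<ge>0. baskakov n (poly p) x = poly q x)"

(* Coefficients of the inverse as a differential operator of infinite order.  The terms with
   k > degree p vanish, so the finite sum is the full series. *)
definition baskakov_eta :: "nat \<Rightarrow> nat \<Rightarrow> real poly" where
  "baskakov_eta n =
     (THE a. \<forall>p. inv (baskakov_poly n) p = (\<Sum>k\<le>degree p. a k * (pderiv ^^ k) p))"

definition baskakov_quasi :: "nat \<Rightarrow> nat \<Rightarrow> (real \<Rightarrow> real) \<Rightarrow> real \<Rightarrow> real" where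
  "baskakov_quasi s n f x = (\<Sum>k\<le>s. poly (baskakov_eta n k) x * (D ^^ k) (baskakov n f) x)"

(* The limit coefficients of index 2r+1 and 2r+2; the former is 0 for r = 0, by the
   convention 1/(-1)! = 0. *)
definition eta_bar_odd :: "nat \<Rightarrow> real \<Rightarrow> real" where
  "eta_bar_odd r x =
     (if r = 0 then 0
      else (-1) ^ (r + 1) / (3 * 2 ^ (r - 1) * fact (r - 1)) * (1 + 2 * x) * (x * (1 + x)) ^ r)"

definition eta_bar_even :: "nat \<Rightarrow> real \<Rightarrow> real" where
  "eta_bar_even r x = (-1) ^ (r + 1) / (2 ^ (r + 1) * fact (r + 1)) * (x * (1 + x)) ^ (r + 1)"

end

theory Submission
  imports Defs
begin

text \<open>
  The inverse operator is determined by its commutation with multiplication by \<open>x\<close>: the Baskakov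
  operator \<open>V\<close> satisfies \<open>V (x g) = (x + X D / n) (V g)\<close>, and writing the inverse as
  \<open>\<Sum> \<eta>\<^sub>k D\<^sup>k\<close> turns this into the three-term recurrence
  \<open>(k + 1) (n + k) \<eta>\<^sub>k\<^sub>+\<^sub>1 = - ((1 + 2 x) k \<eta>\<^sub>k + X \<eta>\<^sub>k\<^sub>-\<^sub>1)\<close>. It gives
  \<open>\<eta>\<^sub>k = O(n ^ (- \<lceil>k / 2\<rceil>))\<close> together with the limit constants. For a function \<open>f = P + R\<close>,
  with \<open>P\<close> its Taylor polynomial of degree \<open>2 r + 3\<close> at \<open>x\<close>, the polynomial part of the error is
  the finite sum of the \<open>\<eta>\<^sub>k D\<^sup>k (V P)\<close> with \<open>k\<close> above the order, while
  \<open>D\<^sup>k (V R) (x) = O(n ^ (- (2 r + 4 - k) / 2))\<close>, because differentiating \<open>V\<close> amounts to taking finite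
  differences and the absolute moments of order \<open>p\<close> are \<open>O(n ^ (- p / 2))\<close>.
\<close>

section \<open>The inverse on polynomials\<close>

text \<open>
  The generating function \<open>h = \<Sum> \<eta>\<^sub>k \<lambda>\<^sup>k\<close> is \<open>exp (- \<lambda> x)\<close> times the confluent hypergeometric
  function with parameters \<open>- n x\<close> and \<open>n\<close> at \<open>- \<lambda>\<close>; Kummer's equation becomes
  \<open>\<lambda> h'' + (n + (1 + 2 x) \<lambda>) h' + X \<lambda> h = 0\<close>, whose coefficients give the recurrence.
\<close>

fun eta :: "nat \<Rightarrow> nat \<Rightarrow> real poly" where
  "eta n 0 = 1"
| "eta n (Suc 0) = 0"
| "eta n (Suc (Suc k)) =
     smult (- 1 / (real (k + 2) * real (n + k + 1)))
       (smult (real (k + 1)) ([:1, 2:] * eta n (Suc k)) + [:0, 1, 1:] * eta n k)"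

lemma eta_recurrence:
  "smult (real (k + 2) * real (n + k + 1)) (eta n (Suc (Suc k))) =
     - (smult (real (k + 1)) ([:1, 2:] * eta n (Suc k)) + [:0, 1, 1:] * eta n k)"
  by (simp del: of_nat_add of_nat_Suc add: smult_minus_left)

declare eta.simps(3) [simp del]

section \<open>The differential operator with these coefficients\<close>

definition eta_op :: "nat \<Rightarrow> real poly \<Rightarrow> real poly" where
  "eta_op n p = (\<Sum>k\<le>degree p. eta n k * (pderiv ^^ k) p)"

lemma higher_pderiv_eq_0: "degree p < k \<Longrightarrow> (pderiv ^^ k) p = 0" for p :: "real poly"
  by (intro poly_eqI) (simp add: coeff_higher_pderiv coeff_eq_0)

text \<open>This allows polynomials of different degrees to share one range of summation.\<close>

lemma eta_op_eq_sum:
  assumes "degree p \<le> N"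
  shows "eta_op n p = (\<Sum>k\<le>N. eta n k * (pderiv ^^ k) p)"
  unfolding eta_op_def
  by (intro sum.mono_neutral_left) (use assms in \<open>auto simp: higher_pderiv_eq_0\<close>)

lemma eta_op_add: "eta_op n (p + q) = eta_op n p + eta_op n q"
proof -
  define N where "N = max (degree p) (degree q)"
  have "degree (p + q) \<le> N" "degree p \<le> N" "degree q \<le> N"
    by (auto simp: N_def degree_add_le_max)
  then show ?thesis
    by (simp add: eta_op_eq_sum higher_pderiv_add distrib_left sum.distrib)
qed

text \<open>The conjugate of multiplication by \<open>x\<close> under the Baskakov operator.\<close>

definition mult_step :: "nat \<Rightarrow> real poly \<Rightarrow> real poly" where
  "mult_step n q = pCons 0 q + smult (1 / real n) ([:0, 1, 1:] * pderiv q)"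

text \<open>Leibniz rule for multiplication by x, which is \<open>pCons 0\<close>. At
  \<open>k = 0\<close> the truncated index \<open>k - 1\<close> is harmless because its factor
  \<open>k\<close> vanishes.\<close>

lemma higher_pderiv_pCons:
  "(pderiv ^^ k) (pCons 0 q) = pCons 0 ((pderiv ^^ k) q) + smult (real k) ((pderiv ^^ (k - 1)) q)"
  for q :: "real poly"
proof (induction k)
  case (Suc k)
  show ?case
  proof (rule poly_ext)
    fix t
    show "poly ((pderiv ^^ Suc k) (pCons 0 q)) t =
      poly (pCons 0 ((pderiv ^^ Suc k) q) + smult (real (Suc k)) ((pderiv ^^ (Suc k - 1)) q)) t"
      using Suc by (cases k) (simp_all add: pderiv_add pderiv_smult pderiv_pCons algebra_simps)
  qed
qed simp

text \<open>Leibniz rule for X = x + x^2, whose derivatives are 1 + 2 x and 2; the second binomial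
  coefficient times 2 is k (k - 1). Truncated indices again meet vanishing factors.\<close>

lemma higher_pderiv_mult_X:
  "(pderiv ^^ k) ([:0, 1, 1:] * g) = [:0, 1, 1:] * (pderiv ^^ k) g
     + smult (real k) ([:1, 2:] * (pderiv ^^ (k - 1)) g)
     + smult (real k * real (k - 1)) ((pderiv ^^ (k - 2)) g)"
  for g :: "real poly"
proof (induction k)
  case (Suc k)
  show ?case
  proof (rule poly_ext)
    fix t
    consider "k = 0" | "k = 1" | j where "k = Suc (Suc j)"
      by (metis One_nat_def not0_implies_Suc)
    then show "poly ((pderiv ^^ Suc k) ([:0, 1, 1:] * g)) t = poly ([:0, 1, 1:] * (pderiv ^^ Suc k) g
     + smult (real (Suc k)) ([:1, 2:] * (pderiv ^^ (Suc k - 1)) g)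
     + smult (real (Suc k) * real (Suc k - 1)) ((pderiv ^^ (Suc k - 2)) g)) t"
      using Suc
      by cases (simp_all add: pderiv_add pderiv_smult pderiv_pCons algebra_simps)
  qed
qed simp

lemma higher_pderiv_mult_step:
  "(pderiv ^^ k) (mult_step n q) = pCons 0 ((pderiv ^^ k) q) + smult (real k) ((pderiv ^^ (k - 1)) q)
     + smult (1 / real n) ([:0, 1, 1:] * (pderiv ^^ (k + 1)) q
        + smult (real k) ([:1, 2:] * (pderiv ^^ k) q)
        + smult (real k * real (k - 1)) ((pderiv ^^ (k - 1)) q))"
proof -
  have *: "(pderiv ^^ j) (pderiv q) = (pderiv ^^ (j + 1)) q" for j
    by (simp del: funpow.simps add: funpow_Suc_right)
  consider "k = 0" | "k = 1" | j where "k = Suc (Suc j)"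
    by (metis One_nat_def not0_implies_Suc)
  then show ?thesis
    unfolding mult_step_def higher_pderiv_add higher_pderiv_smult higher_pderiv_pCons
      higher_pderiv_mult_X *
    by cases (simp_all del: mult_pCons_left)
qed

text \<open>The recurrence for \<^const>\<open>eta\<close> makes the sum telescope.\<close>

lemma sum_eta_mult_step:
  assumes "n > 0"
  shows "(\<Sum>k\<le>N. eta n k * (pderiv ^^ k) (mult_step n q)) =
     pCons 0 (\<Sum>k\<le>N. eta n k * (pderiv ^^ k) q)
     + smult (1 / real n) ([:0, 1, 1:] * eta n N * (pderiv ^^ (N + 1)) q)
     - smult (real (N + 1) * real (n + N) / real n) (eta n (N + 1) * (pderiv ^^ N) q)"
proof (induction N)
  case 0
  then show ?case
    by (simp add: higher_pderiv_mult_step del: funpow.simps)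
next
  case (Suc N)
  have rec: "real (N + 2) * real (n + N + 1) * poly (eta n (Suc (Suc N))) t =
     - (real (N + 1) * ((1 + 2 * t) * poly (eta n (Suc N)) t) + (t + t\<^sup>2) * poly (eta n N) t)" for t
    using arg_cong[OF eta_recurrence[of N n], of "\<lambda>p. poly p t"]
    by (simp add: algebra_simps power2_eq_square)
  show ?case
  proof (rule poly_ext)
    fix t
    define E0 E1 E2 A0 A1 A2 S where abbr:
      "E0 = poly (eta n N) t" "E1 = poly (eta n (Suc N)) t" "E2 = poly (eta n (Suc (Suc N))) t"
      "A0 = poly ((pderiv ^^ N) q) t" "A1 = poly ((pderiv ^^ (Suc N)) q) t"
      "A2 = poly ((pderiv ^^ (Suc (Suc N))) q) t"
      "S = (\<Sum>k\<le>N. poly (eta n k * (pderiv ^^ k) q) t)"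
    have r: "real (N + 2) * real (n + N + 1) / real n * E2 =
      - (real (N + 1) * ((1 + 2 * t) * E1) + (t + t\<^sup>2) * E0) / real n"
      using rec[of t] by (simp add: abbr)
    have "poly (\<Sum>k\<le>Suc N. eta n k * (pderiv ^^ k) (mult_step n q)) t =
      t * S + (t + t\<^sup>2) * E0 * A1 / real n - real (N + 1) * real (n + N) / real n * E1 * A0
      + E1 * (t * A1 + real (N + 1) * A0 +
        ((t + t\<^sup>2) * A2 + real (N + 1) * (1 + 2 * t) * A1 + real (N + 1) * real N * A0) / real n)"
      unfolding sum.atMost_Suc Suc unfolding higher_pderiv_mult_step
      by (simp add: abbr poly_sum algebra_simps add_divide_distrib power2_eq_square del: funpow.simps)
    \<comment> \<open>The terms with \<open>A0\<close> cancel, since N + 1 + (N + 1) N / n = (N + 1)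
      (n + N) / n. Those with \<open>A1\<close>, apart from \<open>t * E1 * A1\<close>, are
      collected by the recurrence into the new boundary term.\<close>
    also have "\<dots> = t * (S + E1 * A1) + (t + t\<^sup>2) * E1 * A2 / real n
       - (real (N + 2) * real (n + N + 1) / real n * E2) * A1"
      unfolding r using assms by (simp add: field_simps)
    also have "\<dots> = poly (pCons 0 (\<Sum>k\<le>Suc N. eta n k * (pderiv ^^ k) q)
     + smult (1 / real n) ([:0, 1, 1:] * eta n (Suc N) * (pderiv ^^ (Suc N + 1)) q)
     - smult (real (Suc N + 1) * real (n + Suc N) / real n) (eta n (Suc N + 1) * (pderiv ^^ Suc N) q)) t"
      by (simp add: abbr poly_sum algebra_simps add_divide_distrib power2_eq_square del: funpow.simps)
    finally show "poly (\<Sum>k\<le>Suc N. eta n k * (pderiv ^^ k) (mult_step n q)) t = \<dots>" .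
  qed
qed

lemma degree_mult_step: "degree (mult_step n q) \<le> Suc (degree q)"
proof -
  have "degree ([:0, 1, 1:] * pderiv q) \<le> Suc (degree q)"
  proof (cases "degree q = 0")
    case False
    have "degree ([:0, 1, 1:] * pderiv q) \<le> degree [:0, 1, 1::real:] + degree (pderiv q)"
      by (rule degree_mult_le)
    also have "\<dots> = Suc (degree q)"
      using False by (simp add: degree_pderiv)
    finally show ?thesis .
  qed (auto simp: pderiv_eq_0_iff[THEN iffD2])
  then show ?thesis
    unfolding mult_step_def
    by (intro degree_add_le degree_pCons_le order.trans[OF degree_smult_le])
qed

text \<open>Once \<open>N\<close> exceeds the degree of \<open>q\<close>, the derivatives in both
  boundary terms of the telescoped sum vanish.\<close>

lemma eta_op_mult_step:
  assumes "n > 0"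
  shows "eta_op n (mult_step n q) = pCons 0 (eta_op n q)"
proof -
  define N where "N = Suc (Suc (degree q))"
  have "degree (mult_step n q) \<le> N" "degree q \<le> N" "degree q < N"
    using degree_mult_step[of n q] by (simp_all add: N_def)
  then show ?thesis
    by (simp add: eta_op_eq_sum[where N = N] sum_eta_mult_step[OF assms] higher_pderiv_eq_0 
      del: funpow.simps)
qed

text \<open>The Baskakov operator on polynomials in Horner form: a + x p goes to a plus
  \<open>mult_step\<close> of the image of p. It is kept free of series until the two are identified
  on the half-line.\<close>

definition baskakov_rec :: "nat \<Rightarrow> real poly \<Rightarrow> real poly" where
  "baskakov_rec n p = fold_coeffs (\<lambda>a q. [:a:] + mult_step n q) p 0"

lemma mult_step_0 [simp]: "mult_step n 0 = 0"
  by (simp add: mult_step_def)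

lemma mult_step_add: "mult_step n (p + q) = mult_step n p + mult_step n q"
  by (rule poly_ext) (simp add: mult_step_def pderiv_add add_divide_distrib algebra_simps)

lemma mult_step_smult: "mult_step n (smult c p) = smult c (mult_step n p)"
  by (simp add: mult_step_def pderiv_smult smult_add_right mult.commute)

lemma baskakov_rec_0 [simp]: "baskakov_rec n 0 = 0"
  by (simp add: baskakov_rec_def)

lemma baskakov_rec_pCons [simp]:
  "baskakov_rec n (pCons a p) = [:a:] + mult_step n (baskakov_rec n p)"
  by (cases "a = 0 \<and> p = 0") (auto simp: baskakov_rec_def)

lemma baskakov_rec_add: "baskakov_rec n (p + q) = baskakov_rec n p + baskakov_rec n q"
  by (induction p q rule: poly_induct2) (simp_all add: mult_step_add)

lemma baskakov_rec_smult: "baskakov_rec n (smult c p) = smult c (baskakov_rec n p)"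
  by (induction p) (simp_all add: mult_step_smult smult_add_right)

lemma degree_baskakov_rec: "degree (baskakov_rec n p) \<le> degree p"
proof (induction p)
  case (pCons a p)
  show ?case
  proof (cases "p = 0")
    case False
    have "degree (mult_step n (baskakov_rec n p)) \<le> Suc (degree p)"
      using degree_mult_step[of n "baskakov_rec n p"] pCons.IH by simp
    with False show ?thesis
      by (auto intro!: degree_add_le)
  qed simp
qed simp

text \<open>Induction along the Horner scheme: \<open>eta_op\<close> fixes constants and turns
  \<open>mult_step\<close> back into multiplication by x.\<close>

lemma eta_op_baskakov_rec:
  assumes "n > 0"
  shows "eta_op n (baskakov_rec n p) = p"
  by (induction p) (simp_all add: eta_op_add eta_op_mult_step assms, simp_all add: eta_op_def)

text \<open>The range is a subspace closed under \<open>mult_step\<close>, which sends x^k to (1 +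
  k/n) x^(k+1) + (k/n) x^k. By induction it contains every monomial.\<close>

lemma surj_baskakov_rec:
  assumes "n > 0"
  shows "surj (baskakov_rec n)"
proof -
  define R where "R = range (baskakov_rec n)"
  have add: "p + q \<in> R" if "p \<in> R" "q \<in> R" for p q
    using that by (auto simp: R_def baskakov_rec_add[symmetric])
  have smult: "smult c p \<in> R" if "p \<in> R" for c p
    using that by (auto simp: R_def baskakov_rec_smult[symmetric])
  have step: "mult_step n p \<in> R" if "p \<in> R" for p
  proof -
    from that obtain q where "p = baskakov_rec n q" by (auto simp: R_def)
    then have "mult_step n p = baskakov_rec n (pCons 0 q)" by simp
    then show ?thesis unfolding R_def by (rule range_eqI)
  qed
  have monom: "monom 1 k \<in> R" for k
  proof (induction k)
    case 0
    have "monom 1 0 = baskakov_rec n [:1:]" by (simp add: monom_0)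
    then show ?case unfolding R_def by (rule range_eqI)
  next
    case (Suc k)
    define c where "c = real k / real n"
    have [simp]: "pderiv (monom 1 k) = monom (real k) (k - 1)"
      by (simp add: pderiv_monom)
    \<comment> \<open>The image of x^k under \<open>mult_step\<close> is solved for x^(k+1); the
      divisor 1 + c is positive.\<close>
    have "monom 1 (Suc k) = smult (1 / (1 + c)) (mult_step n (monom 1 k) + smult (- c) (monom 1 k))"
    proof (rule poly_ext)
      fix t :: real
      have "t * t ^ (k - 1) * real k = t ^ k * real k"
        by (cases k) auto
      then have *: "real k * (t * t ^ (k - 1)) = real k * t ^ k" by (simp add: mult_ac)
      have "c \<ge> 0" by (simp add: c_def)
      have "poly (mult_step n (monom 1 k)) t = t * t ^ k + (1 + t) * (real k * (t * t ^ (k - 1))) / real n"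
        by (simp add: mult_step_def poly_monom algebra_simps add_divide_distrib)
      also have "\<dots> = (1 + c) * t ^ Suc k + c * t ^ k"
        unfolding * by (simp add: c_def algebra_simps add_divide_distrib)
      finally show "poly (monom 1 (Suc k)) t =
        poly (smult (1 / (1 + c)) (mult_step n (monom 1 k) + smult (- c) (monom 1 k))) t"
        using \<open>c \<ge> 0\<close> by (simp add: poly_monom)
    qed
    with Suc add smult step show ?case by metis
  qed
  have "p \<in> R" for p
  proof -
    have sum: "sum g A \<in> R" if "finite A" "\<And>i. i \<in> A \<Longrightarrow> g i \<in> R" for g and A :: "nat set"
      using that
    proof (induction A rule: finite_induct)
      case empty
      show ?case using smult[OF monom[of 0], of 0] by simp
    qed (auto intro: add)
    have "p = (\<Sum>i\<le>degree p. smult (coeff p i) (monom 1 i))"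
      by (simp add: smult_monom poly_as_sum_of_monoms)
    also have "\<dots> \<in> R" by (intro sum smult monom) auto
    finally show ?thesis .
  qed
  then show ?thesis by (auto simp: R_def)
qed

text \<open>\<open>inv\<close> is a choice of preimage, so it equals the left inverse
  \<open>eta_op\<close> only through bijectivity: surjectivity supplies a preimage, the left inverse
  gives injectivity.\<close>

lemma inv_baskakov_rec:
  assumes "n > 0"
  shows "inv (baskakov_rec n) = eta_op n"
proof
  fix p
  obtain q where "p = baskakov_rec n q"
    using surj_baskakov_rec[OF assms] by blast
  moreover have "inj (baskakov_rec n)"
    by (rule inj_on_inverseI[where g = "eta_op n"]) (simp add: eta_op_baskakov_rec assms)
  ultimately show "inv (baskakov_rec n) p = eta_op n p"
    by (simp add: eta_op_baskakov_rec assms)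
qed

text \<open>Test on x^m: the terms of order below m agree by induction, and the m-th derivative of
  x^m is the nonzero constant m!.\<close>

lemma diff_op_coeff_unique:
  fixes a b :: "nat \<Rightarrow> real poly"
  assumes "\<And>p. (\<Sum>k\<le>degree p. a k * (pderiv ^^ k) p) = (\<Sum>k\<le>degree p. b k * (pderiv ^^ k) p)"
  shows "a = b"
proof
  fix m
  show "a m = b m"
  proof (induction m rule: less_induct)
    case (less m)
    have "degree (monom 1 m :: real poly) = m" by (simp add: degree_monom_eq)
    with assms[of "monom 1 m"]
    have "(\<Sum>k<m. a k * (pderiv ^^ k) (monom 1 m)) + a m * (pderiv ^^ m) (monom 1 m) =
      (\<Sum>k<m. b k * (pderiv ^^ k) (monom 1 m)) + b m * (pderiv ^^ m) (monom 1 m)"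
      by (simp add: lessThan_Suc_atMost[symmetric])
    moreover have "(\<Sum>k<m. a k * (pderiv ^^ k) (monom 1 m)) = (\<Sum>k<m. b k * (pderiv ^^ k) (monom 1 m))"
      by (intro sum.cong) (auto simp: less)
    moreover have "coeff ((pderiv ^^ m) (monom 1 m :: real poly)) 0 \<noteq> 0"
      by (simp add: coeff_higher_pderiv pochhammer_fact[symmetric])
    then have "(pderiv ^^ m) (monom 1 m :: real poly) \<noteq> 0" by force
    ultimately show ?case by simp
  qed
qed

lemma poly_eq_on_half_line:
  fixes p q :: "real poly"
  assumes "\<And>x. x \<ge> 0 \<Longrightarrow> poly p x = poly q x"
  shows "p = q"
proof (rule ccontr)
  assume "p \<noteq> q"
  then have "finite {x. poly (p - q) x = 0}" by (intro poly_roots_finite) auto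
  moreover have "{0..} \<subseteq> {x. poly (p - q) x = 0}" using assms by auto
  ultimately show False
    using infinite_Ici finite_subset by blast
qed

section \<open>Convergence of the operators to the identity on a fixed polynomial\<close>

lemma tendsto_higher_pderiv_pCons:
  fixes q :: "nat \<Rightarrow> real poly"
  assumes "\<And>k x. (\<lambda>n. poly ((pderiv ^^ k) (q n)) x) \<longlonglongrightarrow> poly ((pderiv ^^ k) p) x"
  shows "(\<lambda>n. poly ((pderiv ^^ k) (pCons 0 (q n))) x) \<longlonglongrightarrow> poly ((pderiv ^^ k) (pCons 0 p)) x"
  unfolding higher_pderiv_pCons by (auto intro!: tendsto_intros assms simp del: funpow.simps)

text \<open>As 1/n tends to 0, \<open>mult_step\<close> becomes multiplication by x. All derivatives
  and all points are treated at once because \<open>mult_step\<close> itself contains a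
  derivative.\<close>

lemma baskakov_rec_tendsto:
  "(\<lambda>n. poly ((pderiv ^^ k) (baskakov_rec n p)) x) \<longlonglongrightarrow> poly ((pderiv ^^ k) p) x"
proof (induction p arbitrary: k x)
  case (pCons a p)
  have inv0: "(\<lambda>n. 1 / real n) \<longlonglongrightarrow> 0" by (rule lim_1_over_n)
  \<comment> \<open>Multiplication by X is written with two nested multiplications by x, so that the
    limit lemma for \<open>pCons 0\<close> suffices.\<close>
  have X: "[:0, 1, 1:] * pderiv g = pCons 0 (pderiv g + pCons 0 (pderiv g))" for g :: "real poly"
    by simp
  have "(\<lambda>n. poly ((pderiv ^^ k) [:a:] + ((pderiv ^^ k) (pCons 0 (baskakov_rec n p))
        + smult (1 / real n) ((pderiv ^^ k) ([:0, 1, 1:] * pderiv (baskakov_rec n p))))) x)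
     \<longlonglongrightarrow> poly ((pderiv ^^ k) [:a:] + ((pderiv ^^ k) (pCons 0 p)
        + smult 0 ((pderiv ^^ k) ([:0, 1, 1:] * pderiv p)))) x"
  proof -
    have d: "(\<lambda>n. poly ((pderiv ^^ k) (pderiv (baskakov_rec n p))) x)
       \<longlonglongrightarrow> poly ((pderiv ^^ k) (pderiv p)) x" for k x
      using pCons.IH[of "Suc k" x] by (simp del: funpow.simps add: funpow_Suc_right)
    have X: "(\<lambda>n. poly ((pderiv ^^ k) ([:0, 1, 1:] * pderiv (baskakov_rec n p))) x)
       \<longlonglongrightarrow> poly ((pderiv ^^ k) ([:0, 1, 1:] * pderiv p)) x"
      unfolding X
      by (intro tendsto_higher_pderiv_pCons)
        (auto simp: higher_pderiv_add intro!: tendsto_add d tendsto_higher_pderiv_pCons)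
    show ?thesis
      unfolding poly_add poly_smult
      by (intro tendsto_intros tendsto_mult[OF inv0 X] tendsto_higher_pderiv_pCons pCons.IH)
  qed
  moreover have "pCons a p = [:a:] + pCons 0 p" by simp
  then have "(pderiv ^^ k) (pCons a p) = (pderiv ^^ k) [:a:] + ((pderiv ^^ k) (pCons 0 p)
        + smult 0 ((pderiv ^^ k) ([:0, 1, 1:] * pderiv p)))"
    by (simp only: higher_pderiv_add smult_0_left add_0_right)
  ultimately show ?case
    by (simp only: baskakov_rec_pCons mult_step_def higher_pderiv_add higher_pderiv_smult)
qed simp

section \<open>Asymptotics of the coefficients\<close>

text \<open>Both parities advance together because the recurrence mixes them. In the even step the
  odd coefficient carries a spare factor 1/n and drops out; in the odd step both preceding
  coefficients contribute to the limit.\<close>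

lemma eta_tendsto:
  fixes x :: real
  shows "(\<lambda>n. real n ^ m * poly (eta n (2 * m)) x) \<longlonglongrightarrow> (- 1) ^ m / (2 ^ m * fact m) * (x * (1 + x)) ^ m"
    (is "?E m")
    and "(\<lambda>n. real n ^ (m + 1) * poly (eta n (2 * m + 1)) x) \<longlonglongrightarrow> eta_bar_odd m x" (is "?O m")
proof -
  define X where "X = x * (1 + x)"
  have rec: "poly (eta n (Suc (Suc k))) x =
    - 1 / (real (k + 2) * real (n + k + 1)) * (real (k + 1) * (1 + 2 * x) * poly (eta n (Suc k)) x
      + X * poly (eta n k) x)" for n k
    by (simp add: eta.simps X_def algebra_simps)
  have ratio: "(\<lambda>n. - real n / (real (k + 2) * real (n + k + 1))) \<longlonglongrightarrow> - 1 / real (k + 2)" for k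
  proof -
    have "(\<lambda>n. - 1 / real (k + 2) * inverse (1 + real (k + 1) * (1 / real n)))
      \<longlonglongrightarrow> - 1 / real (k + 2) * inverse (1 + real (k + 1) * 0)"
      by (intro tendsto_intros lim_1_over_n) simp
    then have "(\<lambda>n. - 1 / real (k + 2) * inverse (1 + real (k + 1) * (1 / real n)))
      \<longlonglongrightarrow> - 1 / real (k + 2)"
      by simp
    then show ?thesis
    proof (rule Lim_transform_eventually)
      show "\<forall>\<^sub>F n in sequentially. - 1 / real (k + 2) * inverse (1 + real (k + 1) * (1 / real n))
        = - real n / (real (k + 2) * real (n + k + 1))"
        using eventually_gt_at_top[of 0] by eventually_elim (simp add: field_simps)
    qed
  qed
  have inv0: "(\<lambda>n. 1 / real n) \<longlonglongrightarrow> 0" by (rule lim_1_over_n)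
  have "?E m \<and> ?O m"
  proof (induction m)
    case 0
    show ?case by (simp add: eta_bar_odd_def)
  next
    case (Suc m)
    define E where "E = (\<lambda>m. (- 1) ^ m / (2 ^ m * fact m) * X ^ m)"
    from Suc have Em: "(\<lambda>n. real n ^ m * poly (eta n (2 * m)) x) \<longlonglongrightarrow> E m"
      and Om: "(\<lambda>n. real n ^ (m + 1) * poly (eta n (2 * m + 1)) x) \<longlonglongrightarrow> eta_bar_odd m x"
      by (simp_all add: E_def X_def)
    have "(\<lambda>n. - real n / (real (2 * m + 2) * real (n + 2 * m + 1)) *
        (real (2 * m + 1) * (1 + 2 * x) * (1 / real n * (real n ^ (m + 1) * poly (eta n (2 * m + 1)) x))
         + X * (real n ^ m * poly (eta n (2 * m)) x)))
      \<longlonglongrightarrow> - 1 / real (2 * m + 2) *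
        (real (2 * m + 1) * (1 + 2 * x) * (0 * eta_bar_odd m x) + X * E m)"
      by (intro tendsto_intros ratio inv0 Em Om)
    also have "- 1 / real (2 * m + 2) * (real (2 * m + 1) * (1 + 2 * x) * (0 * eta_bar_odd m x) + X * E m)
       = E (Suc m)"
      by (simp add: E_def field_simps)
    finally have E: "(\<lambda>n. real n ^ Suc m * poly (eta n (2 * Suc m)) x) \<longlonglongrightarrow> E (Suc m)"
    proof (rule Lim_transform_eventually)
      show "\<forall>\<^sub>F n in sequentially. - real n / (real (2 * m + 2) * real (n + 2 * m + 1)) *
        (real (2 * m + 1) * (1 + 2 * x) * (1 / real n * (real n ^ (m + 1) * poly (eta n (2 * m + 1)) x))
         + X * (real n ^ m * poly (eta n (2 * m)) x)) = real n ^ Suc m * poly (eta n (2 * Suc m)) x"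
        using eventually_gt_at_top[of 0]
      proof eventually_elim
        case (elim n)
        have "2 * Suc m = Suc (Suc (2 * m))" by simp
        show ?case
          unfolding \<open>2 * Suc m = _\<close> rec using elim by (simp add: field_simps)
      qed
    qed
    have "(\<lambda>n. - real n / (real (2 * m + 1 + 2) * real (n + (2 * m + 1) + 1)) *
        (real (2 * m + 2) * (1 + 2 * x) * (real n ^ Suc m * poly (eta n (2 * Suc m)) x)
         + X * (real n ^ (m + 1) * poly (eta n (2 * m + 1)) x)))
      \<longlonglongrightarrow> - 1 / real (2 * m + 1 + 2) *
        (real (2 * m + 2) * (1 + 2 * x) * E (Suc m) + X * eta_bar_odd m x)"
      by (intro tendsto_intros ratio E Om)
    also have "- 1 / real (2 * m + 1 + 2) *
        (real (2 * m + 2) * (1 + 2 * x) * E (Suc m) + X * eta_bar_odd m x) = eta_bar_odd (Suc m) x"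
    \<comment> \<open>The convention \<open>eta_bar_odd 0 x = 0\<close> is not an instance of the
      closed formula, so the passage from index 0 to 1 is computed separately.\<close>
    proof (cases m)
      case 0
      then show ?thesis by (simp add: E_def X_def eta_bar_odd_def field_simps)
    next
      case m: (Suc j)
      define F :: real where "F = fact j"
      define P :: real where "P = 2 ^ j"
      define Q where "Q = X ^ j"
      define sg :: real where "sg = (- 1) ^ j"
      define J where "J = real j"
      have pos: "F \<noteq> 0" "P \<noteq> 0" "J + 1 \<noteq> 0" "J + 2 \<noteq> 0" "2 * J + 5 \<noteq> 0"
        by (auto simp: F_def P_def J_def)
      have e1: "E (Suc m) = sg / (4 * P * ((J + 2) * ((J + 1) * F))) * (X * (X * Q))"
        by (simp add: E_def m F_def P_def Q_def sg_def J_def mult_ac add_ac)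
      have e2: "eta_bar_odd m x = sg / (3 * P * F) * (1 + 2 * x) * (X * Q)"
        by (simp add: eta_bar_odd_def m F_def P_def Q_def sg_def J_def X_def)
      have e3: "eta_bar_odd (Suc m) x
          = - sg / (3 * (2 * P) * ((J + 1) * F)) * (1 + 2 * x) * (X * (X * Q))"
        by (simp add: eta_bar_odd_def m F_def P_def Q_def sg_def J_def X_def add_ac)
      have r: "real (2 * m + 1 + 2) = 2 * J + 5" "real (2 * m + 2) = 2 * (J + 2)"
        by (simp_all add: m J_def)
      \<comment> \<open>\<open>Z\<close> is the factor common to all three terms; what remains is
        1/(2(J+1)) + 1/3 = (2J+5)/(6(J+1)), where 2J + 5 cancels the denominator of the
        recurrence.\<close>
      define Z where "Z = sg * (1 + 2 * x) * (X * (X * Q)) / (P * F)"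
      have z1: "2 * (J + 2) * (1 + 2 * x) * E (Suc m) = Z / (2 * (J + 1))"
        unfolding e1 Z_def using pos by (simp add: divide_simps) (simp add: algebra_simps)
      have z2: "X * eta_bar_odd m x = Z / 3"
        unfolding e2 Z_def using pos by (simp add: divide_simps)
      have z3: "eta_bar_odd (Suc m) x = - Z / (6 * (J + 1))"
        unfolding e3 Z_def using pos by (simp add: divide_simps)
      have "- 1 / (2 * J + 5) * (Z / (2 * (J + 1)) + Z / 3) = - Z / (6 * (J + 1))"
        using pos by (simp add: divide_simps) (simp add: algebra_simps)
      then show ?thesis unfolding r z1 z2 z3 .
    qed
    finally have O: "(\<lambda>n. real n ^ (Suc m + 1) * poly (eta n (2 * Suc m + 1)) x)
        \<longlonglongrightarrow> eta_bar_odd (Suc m) x"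
    proof (rule Lim_transform_eventually)
      show "\<forall>\<^sub>F n in sequentially. - real n / (real (2 * m + 1 + 2) * real (n + (2 * m + 1) + 1)) *
        (real (2 * m + 2) * (1 + 2 * x) * (real n ^ Suc m * poly (eta n (2 * Suc m)) x)
         + X * (real n ^ (m + 1) * poly (eta n (2 * m + 1)) x))
        = real n ^ (Suc m + 1) * poly (eta n (2 * Suc m + 1)) x"
        using eventually_gt_at_top[of 0]
      proof eventually_elim
        case (elim n)
        have *: "2 * Suc m + 1 = Suc (Suc (2 * m + 1))" "Suc (2 * m + 1) = 2 * Suc m" by simp_all
        show ?case
          unfolding *(1) unfolding rec unfolding *(2) using elim by (simp add: field_simps)
      qed
    qed
    show ?case using E O by (simp only: E_def X_def)
  qed
  then show "?E m" "?O m" by auto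
qed

section \<open>Differentiation of Baskakov series\<close>

definition poly_growth :: "(nat \<Rightarrow> real) \<Rightarrow> bool" where
  "poly_growth a \<longleftrightarrow> (\<exists>C m. \<forall>k. \<bar>a k\<bar> \<le> C * (1 + real k) ^ m)"

lemma poly_growthI: "(\<And>k. \<bar>a k\<bar> \<le> C * (1 + real k) ^ m) \<Longrightarrow> poly_growth a"
  by (auto simp: poly_growth_def)

lemma poly_growthE:
  assumes "poly_growth a"
  obtains C m where "C \<ge> 0" "\<And>k. \<bar>a k\<bar> \<le> C * (1 + real k) ^ m"
proof -
  from assms obtain C m where *: "\<And>k. \<bar>a k\<bar> \<le> C * (1 + real k) ^ m"
    by (auto simp: poly_growth_def)
  moreover from *[of 0] have "C \<ge> 0" by simp
  ultimately show ?thesis using that by blast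
qed

lemma poly_growth_const [intro]: "poly_growth (\<lambda>k. c)"
  by (rule poly_growthI[of _ "\<bar>c\<bar>" 0]) simp

lemma poly_growth_of_nat [intro]: "poly_growth (\<lambda>k. real k)"
  by (rule poly_growthI[of _ 1 1]) simp

lemma poly_growth_mono: "poly_growth b \<Longrightarrow> (\<And>k. \<bar>a k\<bar> \<le> \<bar>b k\<bar>) \<Longrightarrow> poly_growth a"
  unfolding poly_growth_def by (meson order.trans)

lemma poly_growth_abs [intro]: "poly_growth a \<Longrightarrow> poly_growth (\<lambda>k. \<bar>a k\<bar>)"
  by (erule poly_growth_mono) simp

lemma poly_growth_mult [intro]:
  assumes "poly_growth a" "poly_growth b"
  shows "poly_growth (\<lambda>k. a k * b k)"
proof -
  obtain C m where a: "C \<ge> 0" "\<And>k. \<bar>a k\<bar> \<le> C * (1 + real k) ^ m"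
    using poly_growthE[OF assms(1)] by blast
  obtain C' m' where b: "C' \<ge> 0" "\<And>k. \<bar>b k\<bar> \<le> C' * (1 + real k) ^ m'"
    using poly_growthE[OF assms(2)] by blast
  show ?thesis
  proof (rule poly_growthI)
    fix k
    have "\<bar>a k * b k\<bar> \<le> (C * (1 + real k) ^ m) * (C' * (1 + real k) ^ m')"
      unfolding abs_mult using a b by (intro mult_mono) auto
    also have "\<dots> = (C * C') * (1 + real k) ^ (m + m')"
      by (simp add: power_add mult_ac)
    finally show "\<bar>a k * b k\<bar> \<le> (C * C') * (1 + real k) ^ (m + m')" .
  qed
qed

lemma poly_growth_power [intro]: "poly_growth a \<Longrightarrow> poly_growth (\<lambda>k. a k ^ p)"
  by (induction p) auto

lemma poly_growth_add [intro]:
  assumes "poly_growth a" "poly_growth b"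
  shows "poly_growth (\<lambda>k. a k + b k)"
proof -
  obtain C m where a: "C \<ge> 0" "\<And>k. \<bar>a k\<bar> \<le> C * (1 + real k) ^ m"
    using poly_growthE[OF assms(1)] by blast
  obtain C' m' where b: "C' \<ge> 0" "\<And>k. \<bar>b k\<bar> \<le> C' * (1 + real k) ^ m'"
    using poly_growthE[OF assms(2)] by blast
  show ?thesis
  proof (rule poly_growthI)
    fix k
    have "\<bar>a k + b k\<bar> \<le> C * (1 + real k) ^ m + C' * (1 + real k) ^ m'"
      using a(2)[of k] b(2)[of k] by linarith
    also have "\<dots> \<le> C * (1 + real k) ^ (m + m') + C' * (1 + real k) ^ (m + m')"
      using a(1) b(1) by (intro add_mono mult_left_mono power_increasing) auto
    finally show "\<bar>a k + b k\<bar> \<le> (C + C') * (1 + real k) ^ (m + m')"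
      by (simp add: distrib_right)
  qed
qed

lemma poly_growth_diff [intro]:
  assumes "poly_growth a" "poly_growth b"
  shows "poly_growth (\<lambda>k. a k - b k)"
  using poly_growth_add[OF assms(1) poly_growth_mult[OF poly_growth_const[of "- 1"] assms(2)]] by simp

lemma poly_growth_divide [intro]: "poly_growth a \<Longrightarrow> poly_growth (\<lambda>k. a k / c)"
  using poly_growth_mult[of a "\<lambda>_. inverse c"] by (auto simp: divide_inverse)

lemma poly_growth_Suc [intro]:
  assumes "poly_growth a"
  shows "poly_growth (\<lambda>k. a (Suc k))"
proof -
  obtain C m where a: "C \<ge> 0" "\<And>k. \<bar>a k\<bar> \<le> C * (1 + real k) ^ m"
    using poly_growthE[OF assms] by blast
  show ?thesis
  proof (rule poly_growthI)
    fix k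
    have "\<bar>a (Suc k)\<bar> \<le> C * (1 + real (Suc k)) ^ m" by (rule a)
    also have "\<dots> \<le> C * (2 * (1 + real k)) ^ m"
      using a(1) by (intro mult_left_mono power_mono) auto
    finally show "\<bar>a (Suc k)\<bar> \<le> (C * 2 ^ m) * (1 + real k) ^ m"
      by (simp only: power_mult_distrib mult.assoc)
  qed
qed

lemma poly_growth_poly [intro]: "poly_growth a \<Longrightarrow> poly_growth (\<lambda>k. poly p (a k))"
  by (induction p) auto

text \<open>For fixed n = l + 1 the coefficient is (l + k) choose l, which is at most (l + k)^l, a
  polynomial in k.\<close>

lemma poly_growth_binomial [intro]: "poly_growth (\<lambda>k. real ((n + k - 1) choose k))"
proof (cases n)
  case 0
  \<comment> \<open>For \<open>n = 0\<close> truncated subtraction gives 1 at \<open>k = 0\<close>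
    and 0 elsewhere.\<close>
  have "(k - 1) choose k \<le> 1" for k
    by (cases k) (auto simp: binomial_eq_0)
  then show ?thesis
    using 0 of_nat_mono[where 'a = real] by (intro poly_growthI[of _ 1 0]) fastforce
next
  case (Suc l)
  show ?thesis
  proof (rule poly_growthI)
    fix k
    have "(n + k - 1) choose k = (l + k) choose l"
      using Suc binomial_symmetric[of l "l + k"] by simp
    also have "\<dots> \<le> (l + k) ^ l"
      by (cases "l = 0") (auto intro: binomial_le_pow)
    also have "\<dots> \<le> ((l + 1) * (1 + k)) ^ l"
      by (intro power_mono) auto
    finally have "real ((n + k - 1) choose k) \<le> real (((l + 1) * (1 + k)) ^ l)"
      by (rule of_nat_mono)
    also have "\<dots> = (1 + real l) ^ l * (1 + real k) ^ l"
      by (simp add: power_mult_distrib del: mult_Suc mult_Suc_right)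
    finally show "\<bar>real ((n + k - 1) choose k)\<bar> \<le> (1 + real l) ^ l * (1 + real k) ^ l"
      by simp
  qed
qed

text \<open>Termwise differentiation preserves convergence inside the unit disc and raises the
  exponent \<open>m\<close> by one; a comparison then covers general sequences.\<close>

lemma summable_poly_growth:
  assumes "poly_growth a" and "\<bar>u\<bar> < 1"
  shows "summable (\<lambda>k. a k * u ^ k)"
proof -
  have S: "summable (\<lambda>k. (1 + real k) ^ m * u ^ k)" if "\<bar>u\<bar> < 1" for m u
    using that
  proof (induction m arbitrary: u)
    case 0
    then show ?case by (simp add: summable_geometric)
  next
    case (Suc m)
    have "summable (\<lambda>k. real k ^ m * v ^ k)" if "norm v < 1" for v
    proof -
      have "summable (\<lambda>k. v * ((1 + real k) ^ m * v ^ k))"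
        using Suc.IH that by (intro summable_mult) auto
      then have "summable (\<lambda>k. real (Suc k) ^ m * v ^ Suc k)" by (simp add: mult_ac)
      then show ?thesis by (subst (asm) summable_Suc_iff)
    qed
    \<comment> \<open>The differentiated series has coefficients (k + 1) (k + 1)^m.\<close>
    then have "summable (\<lambda>k. diffs (\<lambda>k. real k ^ m) k * u ^ k)"
      using Suc.prems by (intro termdiff_converges[where K = 1]) auto
    then show ?case by (simp add: diffs_def)
  qed
  obtain C m where a: "C \<ge> 0" "\<And>k. \<bar>a k\<bar> \<le> C * (1 + real k) ^ m"
    using poly_growthE[OF assms(1)] by blast
  show ?thesis
  proof (rule summable_comparison_test')
    show "summable (\<lambda>k. C * ((1 + real k) ^ m * \<bar>u\<bar> ^ k))"
      using assms(2) by (intro summable_mult S) auto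
    show "norm (a k * u ^ k) \<le> C * ((1 + real k) ^ m * \<bar>u\<bar> ^ k)" for k
      using mult_right_mono[OF a(2)[of k], of "\<bar>u\<bar> ^ k"] by (simp add: abs_mult power_abs mult_ac)
  qed
qed

text \<open>The coefficients are an arbitrary sequence because differentiation replaces them by
  differences and raises the index of the basis, while the nodes stay at k/n.\<close>

definition bsum :: "nat \<Rightarrow> (nat \<Rightarrow> real) \<Rightarrow> real \<Rightarrow> real" where
  "bsum n a x = (\<Sum>k. a k * baskakov_basis n k x)"

lemma baskakov_eq_bsum: "baskakov n f = bsum n (\<lambda>k. f (real k / real n))"
  by (simp add: baskakov_def bsum_def fun_eq_iff)

lemma baskakov_basis_eq:
  assumes "x \<ge> 0"
  shows "baskakov_basis n k x = real ((n + k - 1) choose k) * (x / (1 + x)) ^ k / (1 + x) ^ n"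
  by (simp add: baskakov_basis_def power_add power_divide)

lemma baskakov_basis_nonneg: "x \<ge> 0 \<Longrightarrow> baskakov_basis n k x \<ge> 0"
  by (simp add: baskakov_basis_def)

lemma summable_bsum:
  assumes "poly_growth a" "x \<ge> 0"
  shows "summable (\<lambda>k. a k * baskakov_basis n k x)"
proof -
  have "summable (\<lambda>k. (a k * real ((n + k - 1) choose k)) * (x / (1 + x)) ^ k / (1 + x) ^ n)"
    using assms
    by (intro summable_divide summable_poly_growth poly_growth_mult poly_growth_binomial) auto
  then show ?thesis using assms by (simp add: baskakov_basis_eq mult.assoc)
qed

lemma sums_bsum: "poly_growth a \<Longrightarrow> x \<ge> 0 \<Longrightarrow> (\<lambda>k. a k * baskakov_basis n k x) sums bsum n a x"
  unfolding bsum_def by (intro summable_sums summable_bsum)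

lemma bsum_add:
  assumes "poly_growth a" "poly_growth b" "x \<ge> 0"
  shows "bsum n (\<lambda>k. a k + b k) x = bsum n a x + bsum n b x"
  using sums_add[OF sums_bsum[OF assms(1,3), of n] sums_bsum[OF assms(2,3), of n]]
  by (simp add: bsum_def sums_iff distrib_right)

lemma bsum_cmult:
  assumes "poly_growth a" "x \<ge> 0"
  shows "bsum n (\<lambda>k. c * a k) x = c * bsum n a x"
  using sums_mult[OF sums_bsum[OF assms, of n], of c]
  by (simp add: bsum_def sums_iff mult.assoc)

lemma bsum_mono:
  assumes "poly_growth a" "poly_growth b" "x \<ge> 0" "\<And>k. a k \<le> b k"
  shows "bsum n a x \<le> bsum n b x"
  unfolding bsum_def
  using assms by (intro suminf_le summable_bsum mult_right_mono baskakov_basis_nonneg)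

lemma abs_bsum_le:
  assumes "poly_growth a" "poly_growth b" "x \<ge> 0" "\<And>k. \<bar>a k\<bar> \<le> b k"
  shows "\<bar>bsum n a x\<bar> \<le> bsum n b x"
proof -
  have "bsum n a x \<le> bsum n b x"
    using assms by (intro bsum_mono) (auto simp: abs_le_iff)
  moreover have "bsum n (\<lambda>k. - 1 * a k) x \<le> bsum n b x"
  proof (rule bsum_mono[OF poly_growth_mult[OF poly_growth_const assms(1)] assms(2,3)])
    show "- 1 * a k \<le> b k" for k using assms(4)[of k] by linarith
  qed
  ultimately show ?thesis
    using bsum_cmult[OF assms(1,3), of n "- 1"] by linarith
qed

section \<open>Finite differences and the derivative of a series\<close>

definition fdiff :: "(nat \<Rightarrow> real) \<Rightarrow> nat \<Rightarrow> real" where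
  "fdiff a k = a (Suc k) - a k"

lemma poly_growth_fdiff [intro]: "poly_growth a \<Longrightarrow> poly_growth (fdiff a)"
  unfolding fdiff_def by (intro poly_growth_diff poly_growth_Suc)

lemma poly_growth_fdiff_power [intro]: "poly_growth a \<Longrightarrow> poly_growth ((fdiff ^^ j) a)"
  by (induction j) auto

text \<open>Both products contain the same number, since (k+1) C(n+k, k+1) = (n+k) C(n+k-1, k) = n
  C(n+k, k). This is the derivative formula read off coefficient by coefficient.\<close>

lemma negbinomial_fdiff_identity:
  assumes "n > 0"
  shows "real (Suc k) * (a (Suc k) * real ((n + Suc k - 1) choose Suc k))
      - (real n + real k) * (a k * real ((n + k - 1) choose k))
    = real n * (fdiff a k * real ((Suc n + k - 1) choose k))"
proof -
  obtain l where n: "n = Suc l" using assms not0_implies_Suc by blast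
  have 1: "real (Suc k) * real ((n + Suc k - 1) choose Suc k) = (real n + real k) * real ((n + k - 1) choose k)"
    using arg_cong[OF Suc_times_binomial_eq[of "l + k" k], of real]
    by (simp only: of_nat_mult) (simp add: n algebra_simps)
  have 2: "(real n + real k) * real ((n + k - 1) choose k) = real n * real ((Suc n + k - 1) choose k)"
  proof -
    have "Suc (l + k) * ((l + k) choose l) = (Suc (l + k) choose Suc l) * Suc l"
      by (rule Suc_times_binomial_eq)
    moreover have "(l + k) choose l = (l + k) choose k"
      using binomial_symmetric[of l "l + k"] by simp
    moreover have "Suc (l + k) choose Suc l = Suc (l + k) choose k"
      using binomial_symmetric[of "Suc l" "Suc (l + k)"] by simp
    ultimately have "Suc (l + k) * ((l + k) choose k) = (Suc (l + k) choose k) * Suc l"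
      by simp
    from arg_cong[OF this, of real] show ?thesis
      by (simp only: of_nat_mult) (simp add: n algebra_simps)
  qed
  have "real (Suc k) * (a (Suc k) * real ((n + Suc k - 1) choose Suc k))
     = a (Suc k) * (real n * real ((Suc n + k - 1) choose k))"
    unfolding 2[symmetric] 1[symmetric] by simp
  moreover have "(real n + real k) * (a k * real ((n + k - 1) choose k))
     = a k * (real n * real ((Suc n + k - 1) choose k))"
    unfolding 2[symmetric] by simp
  ultimately show ?thesis by (simp add: fdiff_def algebra_simps)
qed

text \<open>In the variable \<open>u = x / (1 + x)\<close> the series is a power series divided by \<open>(1 + x) ^ n\<close>.\<close>

definition bseries :: "nat \<Rightarrow> (nat \<Rightarrow> real) \<Rightarrow> real \<Rightarrow> real" where
  "bseries n a u = (\<Sum>k. (a k * real ((n + k - 1) choose k)) * u ^ k)"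

text \<open>All facts come from one power series F in u = x / (1 + x): u F' multiplies the
  coefficients by k, and (1 - u) F' - n F has the difference sequence as coefficients, with 1 - u =
  1 / (1 + x). The shared value \<open>F'\<close> ties the derivative to multiplication by
  k.\<close>

lemma bsum_bseries:
  assumes "poly_growth a" "x \<ge> 0" "n > 0"
  obtains F' where "bsum n a x = bseries n a (x / (1 + x)) / (1 + x) ^ n"
    and "(bseries n a has_real_derivative F') (at (x / (1 + x)))"
    and "bsum n (\<lambda>k. real k * a k) x = x / (1 + x) * F' / (1 + x) ^ n"
    and "real n * bsum (Suc n) (fdiff a) x =
      (F' / (1 + x) - real n * bseries n a (x / (1 + x))) / (1 + x) ^ Suc n"
proof -
  define F where "F = bseries n a"
  define c where "c = (\<lambda>k. a k * real ((n + k - 1) choose k))"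
  define u where "u = x / (1 + x)"
  have c: "poly_growth c" unfolding c_def using assms(1) by (intro poly_growth_mult poly_growth_binomial)
  have dc: "poly_growth (diffs c)"
    unfolding diffs_def using c by (intro poly_growth_mult poly_growth_Suc poly_growth_of_nat) auto
  have u: "\<bar>u\<bar> < 1" using assms(2) by (simp add: u_def)
  have F: "F = (\<lambda>u. \<Sum>k. c k * u ^ k)" by (simp add: F_def c_def bseries_def fun_eq_iff)
  have S0: "(\<lambda>k. c k * u ^ k) sums F u"
    unfolding F by (intro summable_sums summable_poly_growth c u)
  have "(\<lambda>k. c k * u ^ k / (1 + x) ^ n) sums (F u / (1 + x) ^ n)"
    by (intro sums_divide S0)
  then have R0: "bsum n a x = F u / (1 + x) ^ n"
    using assms(2) by (simp add: bsum_def baskakov_basis_eq c_def u_def sums_iff mult_ac)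
  define F' where "F' = (\<Sum>k. diffs c k * u ^ k)"
  have S1: "(\<lambda>k. diffs c k * u ^ k) sums F'"
    unfolding F'_def by (intro summable_sums summable_poly_growth dc u)
  have "(\<lambda>k. real k * c k * u ^ (k - Suc 0)) sums F'"
    using diffs_equiv[OF sums_summable[OF S1]] by (simp add: F'_def)
  then have "(\<lambda>k. u * (real k * c k * u ^ (k - Suc 0))) sums (u * F')"
    by (rule sums_mult)
  moreover have "u * (real k * c k * u ^ (k - Suc 0)) = real k * c k * u ^ k" for k
    by (cases k) auto
  ultimately have S2: "(\<lambda>k. real k * c k * u ^ k) sums (u * F')" by simp
  have R1: "(F has_real_derivative F') (at u)"
    unfolding F F'_def
    by (rule termdiffs_strong'[where K = 1]) (use u in \<open>auto intro!: summable_poly_growth c\<close>)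
  have R2: "bsum n (\<lambda>k. real k * a k) x = u * F' / (1 + x) ^ n"
    using sums_divide[OF S2, of "(1 + x) ^ n"] assms(2)
    by (simp add: bsum_def baskakov_basis_eq c_def u_def sums_iff mult_ac)
  have R3: "real n * bsum (Suc n) (fdiff a) x = (F' / (1 + x) - real n * F u) / (1 + x) ^ Suc n"
  proof -
    have "(\<lambda>k. (diffs c k * u ^ k - real k * c k * u ^ k - real n * (c k * u ^ k)) / (1 + x) ^ Suc n)
        sums ((F' - u * F' - real n * F u) / (1 + x) ^ Suc n)"
      by (intro sums_divide sums_diff sums_mult S0 S1 S2)
    moreover have "(diffs c k * u ^ k - real k * c k * u ^ k - real n * (c k * u ^ k)) / (1 + x) ^ Suc n
       = real n * (fdiff a k * baskakov_basis (Suc n) k x)" for k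
    proof -
      have "diffs c k - real k * c k - real n * c k =
        real n * (fdiff a k * real ((Suc n + k - 1) choose k))"
        using negbinomial_fdiff_identity[OF assms(3), of k a] by (simp add: c_def diffs_def algebra_simps)
      moreover have "diffs c k * u ^ k - real k * c k * u ^ k - real n * (c k * u ^ k)
        = (diffs c k - real k * c k - real n * c k) * u ^ k"
        by (simp add: algebra_simps)
      ultimately show ?thesis using assms(2) by (simp add: baskakov_basis_eq u_def)
    qed
    ultimately have "(\<lambda>k. real n * (fdiff a k * baskakov_basis (Suc n) k x))
        sums ((F' - u * F' - real n * F u) / (1 + x) ^ Suc n)" by simp
    moreover have "(\<lambda>k. real n * (fdiff a k * baskakov_basis (Suc n) k x))
        sums (real n * bsum (Suc n) (fdiff a) x)"
      using assms by (intro sums_mult sums_bsum poly_growth_fdiff)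
    moreover have "F' - u * F' = F' / (1 + x)"
      using assms(2) by (simp add: u_def field_simps)
    ultimately show ?thesis using sums_unique2 by metis
  qed
  show ?thesis
    by (rule that[OF R0[unfolded F_def u_def] R1[unfolded F_def u_def] R2[unfolded u_def]
        R3[unfolded F_def u_def]])
qed

text \<open>Quotient rule for F(u) / (1 + x)^n, with du/dx = 1 / (1 + x)^2.\<close>

lemma has_real_derivative_bsum:
  assumes "poly_growth a" "x \<ge> 0" "n > 0"
  shows "(bsum n a has_real_derivative real n * bsum (Suc n) (fdiff a) x) (at x within {0..})"
proof -
  define F where "F = bseries n a"
  obtain F' where F': "bsum n a x = F (x / (1 + x)) / (1 + x) ^ n"
    "(F has_real_derivative F') (at (x / (1 + x)))"
    "bsum n (\<lambda>k. real k * a k) x = x / (1 + x) * F' / (1 + x) ^ n"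
    "real n * bsum (Suc n) (fdiff a) x = (F' / (1 + x) - real n * F (x / (1 + x))) / (1 + x) ^ Suc n"
    unfolding F_def by (rule bsum_bseries[OF assms])
  have pos: "1 + x \<noteq> 0" using assms(2) by simp
  have "((\<lambda>x. x / (1 + x)) has_real_derivative (1 / (1 + x)\<^sup>2)) (at x within {0..})"
    using pos by (auto intro!: derivative_eq_intros simp: power2_eq_square)
  note DERIV_chain2[OF F'(2) this]
  moreover have "((\<lambda>y. (1 + y) ^ n) has_real_derivative real n * (1 + x) ^ (n - 1)) (at x within {0..})"
    by (auto intro!: derivative_eq_intros)
  ultimately have "((\<lambda>y. F (y / (1 + y)) / (1 + y) ^ n) has_real_derivative
     (F' * (1 / (1 + x)\<^sup>2) * (1 + x) ^ n - F (x / (1 + x)) * (real n * (1 + x) ^ (n - 1))) / ((1 + x) ^ n * (1 + x) ^ n))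
     (at x within {0..})"
    by (rule DERIV_divide) (use pos in simp)
  moreover have "(F' * (1 / (1 + x)\<^sup>2) * (1 + x) ^ n - F (x / (1 + x)) * (real n * (1 + x) ^ (n - 1))) / ((1 + x) ^ n * (1 + x) ^ n)
     = real n * bsum (Suc n) (fdiff a) x"
  proof -
    \<comment> \<open>Here \<open>Y\<close> stands for 1 + x and \<open>P\<close> for (1 + x)^(n-1),
      which leaves a purely rational identity.\<close>
    have *: "(A * (1 / Y\<^sup>2) * (Y * P) - B * (N * P)) / ((Y * P) * (Y * P)) = (A / Y - N * B) / (Y * (Y * P))"
      if "Y \<noteq> 0" "P \<noteq> 0" for A B N P Y :: real
      using that by (simp add: field_simps power2_eq_square)
    obtain l where l: "n = Suc l" using assms(3) not0_implies_Suc by blast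
    have "(1 + x) ^ l \<noteq> 0" using pos by simp
    from *[OF pos this, of F' "F (x / (1 + x))" "real n"] show ?thesis
      unfolding F'(4) by (simp only: l power_Suc diff_Suc_1)
  qed
  ultimately have "((\<lambda>y. F (y / (1 + y)) / (1 + y) ^ n) has_real_derivative real n * bsum (Suc n) (fdiff a) x)
     (at x within {0..})"
    by (simp only:)
  moreover have "bsum n a y = F (y / (1 + y)) / (1 + y) ^ n" if "y \<ge> 0" for y
    unfolding F_def by (rule bsum_bseries[OF assms(1) that assms(3)])
  ultimately show ?thesis
    by (elim has_field_derivative_transform_within[where d = 1]) (use assms(2) in simp_all)
qed

text \<open>Eliminating \<open>F'\<close> gives the series counterpart of \<open>mult_step\<close>,
  multiplied by n.\<close>

lemma bsum_of_nat_mult: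
  assumes "poly_growth a" "x \<ge> 0" "n > 0"
  shows "bsum n (\<lambda>k. real k * a k) x
    = real n * x * bsum n a x + x * (1 + x) * (real n * bsum (Suc n) (fdiff a) x)"
proof -
  obtain F' where F': "bsum n a x = bseries n a (x / (1 + x)) / (1 + x) ^ n"
    "(bseries n a has_real_derivative F') (at (x / (1 + x)))"
    "bsum n (\<lambda>k. real k * a k) x = x / (1 + x) * F' / (1 + x) ^ n"
    "real n * bsum (Suc n) (fdiff a) x =
      (F' / (1 + x) - real n * bseries n a (x / (1 + x))) / (1 + x) ^ Suc n"
    by (rule bsum_bseries[OF assms])
  have *: "x / Y * A / P = N * x * (B / P) + x * Y * ((A / Y - N * B) / (Y * P))"
    if "Y \<noteq> 0" "P \<noteq> 0" for A B N P Y :: real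
    using that by (simp add: field_simps)
  have "1 + x \<noteq> 0" "(1 + x) ^ n \<noteq> 0" using assms(2) by auto
  from *[OF this, of F' "real n" "bseries n a (x / (1 + x))"] show ?thesis
    unfolding F'(1,3,4) by (simp only: power_Suc)
qed

text \<open>A constant sequence has zero differences, so the sum has derivative 0 and equals its
  value at the origin.\<close>

lemma bsum_const:
  assumes "x \<ge> 0" "n > 0"
  shows "bsum n (\<lambda>k. c) x = c"
proof -
  have "(bsum n (\<lambda>k. c) has_real_derivative 0) (at t within {0..})" if "t \<in> {0..}" for t
    using has_real_derivative_bsum[OF poly_growth_const, of t n c] that assms(2)
    by (simp add: fdiff_def bsum_def)
  then obtain d where "\<forall>t\<in>{0..}. bsum n (\<lambda>k. c) t = d"
    using has_field_derivative_zero_constant[OF convex_real_interval(1)] by blast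
  then have "bsum n (\<lambda>k. c) x = bsum n (\<lambda>k. c) 0"
    using assms(1) by simp
  \<comment> \<open>At x = 0 every basis function with positive \<open>k\<close> vanishes.\<close>
  also have "\<dots> = (\<Sum>k. if k = 0 then c else 0)"
    unfolding bsum_def by (intro suminf_cong) (auto simp: baskakov_basis_def)
  also have "\<dots> = c"
    by (subst suminf_finite[of "{0}"]) auto
  finally show ?thesis .
qed

section \<open>Identification of the formal operator with the series\<close>

lemma at_half_line_neq_bot: "t \<ge> 0 \<Longrightarrow> at t within {0..} \<noteq> bot" for t :: real
proof -
  assume "t \<ge> 0"
  then have "{t<..} \<subseteq> {0..}" by auto
  from at_le[OF this, of t] show ?thesis
    using trivial_limit_at_right_real[of t] by (metis bot.extremum_uniqueI)
qed

text \<open>Horner induction. The series and the polynomial agree on the half-line, so uniqueness of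
  the derivative there, one-sided at 0, identifies the derivative term of
  \<open>bsum_of_nat_mult\<close> with that of \<open>mult_step\<close>.\<close>

lemma baskakov_poly_eq_rec:
  assumes "x \<ge> 0" "n > 0"
  shows "baskakov n (poly p) x = poly (baskakov_rec n p) x"
  using assms(1)
proof (induction p arbitrary: x)
  case 0
  then show ?case by (simp add: baskakov_def)
next
  case (pCons a p)
  define b where "b = (\<lambda>k. poly p (real k / real n))"
  have b: "poly_growth b"
    unfolding b_def by (intro poly_growth_poly poly_growth_divide poly_growth_of_nat)
  have IH: "bsum n b t = poly (baskakov_rec n p) t" if "t \<ge> 0" for t
    using pCons.IH[OF that] by (simp add: baskakov_eq_bsum b_def)
  have "(bsum n b has_real_derivative poly (pderiv (baskakov_rec n p)) x) (at x within {0..})"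
    by (rule has_field_derivative_transform_within[where d = 1 and f = "poly (baskakov_rec n p)"])
      (use pCons.prems IH in \<open>auto intro: has_field_derivative_at_within poly_DERIV\<close>)
  with has_real_derivative_bsum[OF b pCons.prems assms(2)]
  have deriv: "real n * bsum (Suc n) (fdiff b) x = poly (pderiv (baskakov_rec n p)) x"
    unfolding has_real_derivative_iff_has_vector_derivative
    by (rule vector_derivative_unique_within[OF at_half_line_neq_bot[OF pCons.prems]])
  have "baskakov n (poly (pCons a p)) x = bsum n (\<lambda>k. a + (1 / real n) * (real k * b k)) x"
    by (simp add: baskakov_eq_bsum b_def)
  also have "\<dots> = a + (1 / real n) * bsum n (\<lambda>k. real k * b k) x"
    using bsum_add[OF poly_growth_const[of a]
        poly_growth_mult[OF poly_growth_const[of "1 / real n"] poly_growth_mult[OF poly_growth_of_nat b]]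
        pCons.prems, of n]
      bsum_cmult[OF poly_growth_mult[OF poly_growth_of_nat b] pCons.prems, of n "1 / real n"]
      bsum_const[OF pCons.prems assms(2), of a]
    by linarith
  also have "\<dots> = poly (baskakov_rec n (pCons a p)) x"
    unfolding bsum_of_nat_mult[OF b pCons.prems assms(2)] deriv IH[OF pCons.prems]
    using assms(2) by (simp add: mult_step_def field_simps)
  finally show ?case .
qed

lemma baskakov_poly_eq: "n > 0 \<Longrightarrow> baskakov_poly n = baskakov_rec n"
  unfolding baskakov_poly_def
proof (intro ext the_equality)
  fix p q
  assume n: "n > 0" and q: "\<forall>x\<ge>0. baskakov n (poly p) x = poly q x"
  show "q = baskakov_rec n p"
    by (rule poly_eq_on_half_line) (use q baskakov_poly_eq_rec[OF _ n] in simp)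
qed (simp add: baskakov_poly_eq_rec)

lemma baskakov_eta_eq:
  assumes "n > 0"
  shows "baskakov_eta n = eta n"
  unfolding baskakov_eta_def baskakov_poly_eq[OF assms] inv_baskakov_rec[OF assms] eta_op_def
  by (rule the_equality) (simp, rule diff_op_coeff_unique, metis)

section \<open>Moments and the Taylor remainder\<close>

text \<open>The point y with y / (1 + y) = w x / (1 + x) absorbs w^k: the weighted basis at
  \<open>x\<close> is a multiple of the basis at \<open>y\<close>, which sums to 1. The condition on
  \<open>w\<close> makes y nonnegative.\<close>

lemma baskakov_mgf:
  assumes "x \<ge> 0" "n > 0" "w \<ge> 0" "x * (w - 1) < 1"
  shows "(\<lambda>k. w ^ k * baskakov_basis n k x) sums (1 / (1 - x * (w - 1))) ^ n"
proof -
  define d where "d = 1 - x * (w - 1)"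
  define y where "y = x * w / d"
  have d: "d > 0" using assms(4) by (simp add: d_def)
  have y: "y \<ge> 0" using assms d by (simp add: y_def)
  have y1: "1 + y = (1 + x) / d" using d by (simp add: y_def field_simps) (simp add: d_def algebra_simps)
  have y_div: "y / (1 + y) = w * (x / (1 + x))"
    unfolding y1 using d assms(1) by (simp add: y_def field_simps)
  have eq: "baskakov_basis n k y * (1 / d) ^ n = w ^ k * baskakov_basis n k x" for k
    unfolding baskakov_basis_eq[OF y] baskakov_basis_eq[OF assms(1)] y_div unfolding y1
    using d assms(1) by (simp add: power_mult_distrib power_divide field_simps)
  have "(\<lambda>k. 1 * baskakov_basis n k y) sums bsum n (\<lambda>k. 1) y"
    by (intro sums_bsum poly_growth_const y)
  then have "(\<lambda>k. baskakov_basis n k y) sums 1"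
    by (simp add: bsum_const y assms)
  from sums_mult2[OF this, of "(1 / d) ^ n"]
  have "(\<lambda>k. w ^ k * baskakov_basis n k x) sums (1 / d) ^ n"
    by (simp only: eq mult_1_left)
  then show ?thesis by (simp only: d_def)
qed

lemma exp_le_quadratic:
  fixes t :: real
  assumes "\<bar>t\<bar> \<le> 1"
  shows "exp t \<le> 1 + t + t\<^sup>2"
proof (cases "t \<ge> 0")
  case True
  then show ?thesis using assms exp_bound[of t] by simp
next
  case False
  \<comment> \<open>For negative t this product is 1 - t^3, and 1 - t is at most exp (- t).\<close>
  have "1 \<le> (1 - t) * (1 + t + t\<^sup>2)"
  proof -
    have "(1 - t) * (1 + t + t\<^sup>2) = 1 + (- t) * t\<^sup>2"
      by (simp add: algebra_simps power2_eq_square)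
    moreover have "(- t) * t\<^sup>2 \<ge> 0" using False by (intro mult_nonneg_nonneg) auto
    ultimately show ?thesis by linarith
  qed
  also have "\<dots> \<le> exp (- t) * (1 + t + t\<^sup>2)"
  proof (rule mult_right_mono)
    show "1 - t \<le> exp (- t)" using exp_ge_add_one_self[of "- t"] by simp
    show "0 \<le> 1 + t + t\<^sup>2" using assms by (simp add: abs_le_iff)
  qed
  finally show ?thesis by (simp add: exp_minus field_simps)
qed

text \<open>With z = x (exp t - 1), the logarithm of the left side is - n x t - (n + j) ln (1 - z).
  As z = x t + O(1/n), the growing term n x t cancels. The threshold on n ensures that the absolute
  value of z is at most 1/2, as the logarithmic estimate needs.\<close>

lemma baskakov_mgf_bound:
  assumes x: "x \<ge> 0" and n: "n > 0" "16 * x\<^sup>2 \<le> real n" and t: "t\<^sup>2 = 1 / real n"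
  shows "x * (exp t - 1) < 1"
    and "exp (- (real n * x * t)) * (1 / (1 - x * (exp t - 1))) ^ (n + j)
       \<le> exp (real j * x + (1 + real j) * (x + 8 * x\<^sup>2))"
proof -
  define z where "z = x * (exp t - 1)"
  have t2: "t\<^sup>2 \<le> 1" using n(1) by (simp add: t)
  then have t1: "\<bar>t\<bar> \<le> 1" by (simp add: abs_square_le_1)
  then have tt: "t\<^sup>2 \<le> \<bar>t\<bar>"
    by (metis abs_ge_zero mult_left_le power2_abs power2_eq_square)
  have lower: "t \<le> exp t - 1" using exp_ge_add_one_self[of t] by linarith
  have upper: "exp t - 1 \<le> t + t\<^sup>2" using exp_le_quadratic[OF t1] by linarith
  have "\<bar>exp t - 1\<bar> \<le> 2 * \<bar>t\<bar>" using lower upper tt by linarith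
  then have z_abs: "\<bar>z\<bar> \<le> x * (2 * \<bar>t\<bar>)"
    unfolding z_def abs_mult using x by (intro mult_mono) auto
  have "(x * (2 * \<bar>t\<bar>))\<^sup>2 = 4 * x\<^sup>2 / real n"
    by (simp add: power_mult_distrib t)
  also have "\<dots> \<le> (1 / 2)\<^sup>2"
    using n by (simp add: field_simps power2_eq_square)
  finally have "x * (2 * \<bar>t\<bar>) \<le> 1 / 2"
    by (rule power2_le_imp_le) simp
  with z_abs have z2: "\<bar>z\<bar> \<le> 1 / 2" by linarith
  then show "x * (exp t - 1) < 1" unfolding z_def by linarith
  have "\<bar>z\<bar>\<^sup>2 \<le> (x * (2 * \<bar>t\<bar>))\<^sup>2" using z_abs by (intro power_mono) auto
  then have zsq: "z\<^sup>2 \<le> 4 * x\<^sup>2 / real n" by (simp add: power_mult_distrib t mult.commute)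
  have zle: "z \<le> x * t + x / real n"
    using mult_left_mono[OF upper x] t by (simp add: z_def algebra_simps)
  \<comment> \<open>The constant x + 8 x^2 collects x/n from \<open>zle\<close> and 2 * 4 x^2 / n
    from \<open>zsq\<close>.\<close>
  have "- ln (1 - z) \<le> z + 2 * z\<^sup>2"
    using abs_ln_one_plus_x_minus_x_bound[of "- z"] z2 by (simp add: abs_le_iff)
  also have "\<dots> \<le> x * t + (x + 8 * x\<^sup>2) / real n"
    using zle zsq by (simp add: add_divide_distrib)
  finally have ln: "- ln (1 - z) \<le> x * t + (x + 8 * x\<^sup>2) / real n" .
  have "1 / (1 - z) = exp (- ln (1 - z))"
    using z2 by (simp add: exp_minus field_simps)
  then have "exp (- (real n * x * t)) * (1 / (1 - z)) ^ (n + j)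
     = exp (- (real n * x * t) + real (n + j) * (- ln (1 - z)))"
    by (simp only: exp_add exp_of_nat_mult)
  also have "\<dots> \<le> exp (real j * x + (1 + real j) * (x + 8 * x\<^sup>2))"
  proof -
    have "real (n + j) * (- ln (1 - z)) \<le> real (n + j) * (x * t + (x + 8 * x\<^sup>2) / real n)"
      by (intro mult_left_mono ln) auto
    also have "\<dots> = real n * x * t + real j * x * t + (real (n + j) / real n) * (x + 8 * x\<^sup>2)"
      by (simp add: algebra_simps add_divide_distrib)
    also have "\<dots> \<le> real n * x * t + real j * x + (1 + real j) * (x + 8 * x\<^sup>2)"
    proof -
      have "real j * x * t \<le> real j * x"
        using t1 x by (intro mult_left_le) auto
      moreover have "(real (n + j) / real n) * (x + 8 * x\<^sup>2) \<le> (1 + real j) * (x + 8 * x\<^sup>2)"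
      proof (intro mult_right_mono)
        have "real j * 1 \<le> real j * real n" using n(1) by (intro mult_left_mono) auto
        then show "real (n + j) / real n \<le> 1 + real j" using n(1) by (simp add: field_simps)
        show "0 \<le> x + 8 * x\<^sup>2" using x by simp
      qed
      ultimately show ?thesis by linarith
    qed
    finally show ?thesis by simp
  qed
  finally show "exp (- (real n * x * t)) * (1 / (1 - x * (exp t - 1))) ^ (n + j)
       \<le> exp (real j * x + (1 + real j) * (x + 8 * x\<^sup>2))"
    by (simp only: z_def)
qed

text \<open>One term of the exponential series is at most its sum.\<close>

lemma power_le_fact_exp:
  fixes y :: real
  assumes "y \<ge> 0"
  shows "y ^ p \<le> fact p * exp y"
proof -
  have "(\<Sum>k\<in>{p}. y ^ k /\<^sub>R fact k) \<le> (\<Sum>k. y ^ k /\<^sub>R fact k)"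
    using assms sums_summable[OF exp_converges[of y]] by (intro sum_le_suminf) auto
  also have "\<dots> = exp y"
    using exp_converges[of y] by (simp add: sums_iff)
  finally show ?thesis by (simp add: field_simps)
qed

text \<open>The moments are controlled by the exponential moments at \<open>\<plusminus> 1 / sqrt n\<close>.\<close>

lemma baskakov_moment_bound:
  fixes x :: real
  assumes x: "x \<ge> 0"
  shows "\<exists>C. \<forall>n>0. 16 * x\<^sup>2 \<le> real n \<longrightarrow>
     bsum (n + j) (\<lambda>k. \<bar>real k / real n - x\<bar> ^ p) x * sqrt (real n) ^ p \<le> C"
proof -
  define M where "M = exp (real j * x + (1 + real j) * (x + 8 * x\<^sup>2))"
  have "bsum (n + j) (\<lambda>k. \<bar>real k / real n - x\<bar> ^ p) x * sqrt (real n) ^ p \<le> fact p * (2 * M)"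
    if n: "n > 0" "16 * x\<^sup>2 \<le> real n" for n
  proof -
    define s where "s = sqrt (real n)"
    have s: "s > 0" "s\<^sup>2 = real n" using n by (simp_all add: s_def)
    define E where "E = (\<lambda>t k. exp (- (real n * x * t)) * (exp t ^ k * baskakov_basis (n + j) k x))"
    have E_sums: "E t sums (exp (- (real n * x * t)) * (1 / (1 - x * (exp t - 1))) ^ (n + j))"
      and E_le: "exp (- (real n * x * t)) * (1 / (1 - x * (exp t - 1))) ^ (n + j) \<le> M"
      if "t\<^sup>2 = 1 / real n" for t
      unfolding E_def M_def
      using baskakov_mgf_bound[OF x n that] n x by (auto intro!: sums_mult baskakov_mgf)
    have E_eq: "E t k = exp (t * (real k - real n * x)) * baskakov_basis (n + j) k x" for t k
      by (simp add: E_def algebra_simps exp_diff exp_minus field_simps flip: exp_of_nat_mult)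
    have sq: "(1 / s)\<^sup>2 = 1 / real n" "(- 1 / s)\<^sup>2 = 1 / real n"
      by (simp_all add: power_divide s)
    have pw: "\<bar>real k / real n - x\<bar> ^ p * s ^ p * baskakov_basis (n + j) k x
        \<le> fact p * (E (1 / s) k + E (- 1 / s) k)" for k
    proof -
      \<comment> \<open>The deviation is rescaled by sqrt n; its power is at most p! exp |y|, hence
        at most p! times the sum of both centred exponentials.\<close>
      define y where "y = (real k - real n * x) / s"
      have "\<bar>real k / real n - x\<bar> * s = \<bar>y\<bar>"
      proof -
        have "(real k / real n - x) * s = y"
          using s n by (simp add: y_def field_simps power2_eq_square flip: s(2))
        then show ?thesis using s(1) by (metis abs_mult abs_of_pos)
      qed
      then have "\<bar>real k / real n - x\<bar> ^ p * s ^ p = \<bar>y\<bar> ^ p"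
        by (metis power_mult_distrib)
      also have "\<dots> \<le> fact p * exp \<bar>y\<bar>" by (rule power_le_fact_exp) simp
      also have "\<dots> \<le> fact p * (exp y + exp (- y))"
        by (intro mult_left_mono) (auto simp: abs_if)
      finally have "\<bar>real k / real n - x\<bar> ^ p * s ^ p * baskakov_basis (n + j) k x
          \<le> fact p * (exp y + exp (- y)) * baskakov_basis (n + j) k x"
        by (intro mult_right_mono baskakov_basis_nonneg x)
      also have "\<dots> = fact p * (E (1 / s) k + E (- 1 / s) k)"
        by (simp add: E_eq y_def algebra_simps diff_divide_distrib)
      finally show ?thesis .
    qed
    have "poly_growth (\<lambda>k. \<bar>real k / real n - x\<bar> ^ p)"
      by (intro poly_growth_power poly_growth_abs poly_growth_diff poly_growth_divide
          poly_growth_of_nat poly_growth_const)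
    from sums_mult2[OF sums_bsum[OF this x, of "n + j"], of "s ^ p"]
    have "(\<lambda>k. \<bar>real k / real n - x\<bar> ^ p * s ^ p * baskakov_basis (n + j) k x)
       sums (bsum (n + j) (\<lambda>k. \<bar>real k / real n - x\<bar> ^ p) x * s ^ p)"
      by (simp only: mult_ac)
    from sums_le[OF pw this sums_mult[OF sums_add[OF E_sums[OF sq(1)] E_sums[OF sq(2)]]]]
    have "bsum (n + j) (\<lambda>k. \<bar>real k / real n - x\<bar> ^ p) x * s ^ p \<le> fact p *
      (exp (- (real n * x * (1 / s))) * (1 / (1 - x * (exp (1 / s) - 1))) ^ (n + j) +
       exp (- (real n * x * (- 1 / s))) * (1 / (1 - x * (exp (- 1 / s) - 1))) ^ (n + j))" .
    also have "\<dots> \<le> fact p * (M + M)"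
      by (intro mult_left_mono add_mono E_le sq) auto
    finally show ?thesis by (simp add: s_def)
  qed
  then show ?thesis by blast
qed

section \<open>Mean value estimates for differences and Taylor remainders\<close>

lemma abs_diff_le_half_line:
  fixes g g' :: "real \<Rightarrow> real"
  assumes "\<And>t. t \<ge> 0 \<Longrightarrow> (g has_real_derivative g' t) (at t within {0..})"
    and "\<And>t. t \<in> S \<Longrightarrow> \<bar>g' t\<bar> \<le> M" "convex S" "S \<subseteq> {0..}" "a \<in> S" "b \<in> S"
  shows "\<bar>g b - g a\<bar> \<le> M * \<bar>b - a\<bar>"
proof -
  have "norm (g b - g a) \<le> M * norm (b - a)"
  proof (rule field_differentiable_bound[OF assms(3)])
    show "(g has_field_derivative g' t) (at t within S)" if "t \<in> S" for t
      using assms(1,4) that by (meson atLeast_iff DERIV_subset subsetD)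
  qed (use assms in auto)
  then show ?thesis by simp
qed

text \<open>One difference replaces the family \<open>G\<close> of successive derivatives by
  \<open>H\<close>, the increments over a step \<open>h\<close>; the mean value bound yields a
  factor \<open>h\<close>, and induction does the rest.\<close>

lemma fdiff_power_bound:
  fixes G :: "nat \<Rightarrow> real \<Rightarrow> real"
  assumes "\<And>i t. i < j \<Longrightarrow> t \<ge> 0 \<Longrightarrow> (G i has_real_derivative G (Suc i) t) (at t within {0..})"
    and h: "h \<ge> 0"
    and "\<And>t. t \<in> {real k * h..real (k + j) * h} \<Longrightarrow> \<bar>G j t\<bar> \<le> M"
  shows "\<bar>(fdiff ^^ j) (\<lambda>k. G 0 (real k * h)) k\<bar> \<le> h ^ j * M"
  using assms(1,3)
proof (induction j arbitrary: G M)
  case 0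
  then show ?case by simp
next
  case (Suc j)
  define H where "H = (\<lambda>i t. G i (t + h) - G i t)"
  have "\<bar>(fdiff ^^ j) (\<lambda>k. H 0 (real k * h)) k\<bar> \<le> h ^ j * (M * h)"
  proof (rule Suc.IH)
    fix i t assume i: "i < j" and t: "(t::real) \<ge> 0"
    have "((\<lambda>t. t + h) has_real_derivative 1) (at t within {0..})"
      by (auto intro!: derivative_eq_intros)
    \<comment> \<open>The translate of the half-line by \<open>h\<close> lies inside it, so the
      one-sided derivative restricts and the chain rule applies at 0 as well.\<close>
    moreover have "(G i has_real_derivative G (Suc i) (t + h)) (at (t + h) within (\<lambda>t. t + h) ` {0..})"
      by (rule DERIV_subset[OF Suc.prems(1)]) (use i t h in auto)
    ultimately have "((\<lambda>t. G i (t + h)) has_real_derivative G (Suc i) (t + h) * 1) (at t within {0..})"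
      using DERIV_image_chain[of "G i" "G (Suc i) (t + h)" "\<lambda>t. t + h" t "{0..}" 1]
      by (simp add: o_def)
    then show "(H i has_real_derivative H (Suc i) t) (at t within {0..})"
      unfolding H_def using Suc.prems(1)[of i t] i t by (auto intro!: DERIV_diff)
  next
    fix t assume t: "t \<in> {real k * h..real (k + j) * h}"
    have "real k * h \<ge> 0" using h by simp
    with t have "t \<ge> 0" by (meson atLeastAtMost_iff order_trans)
    have sub: "{t..t + h} \<subseteq> {real k * h..real (k + Suc j) * h}"
      using t by (auto simp: algebra_simps)
    have "\<bar>G j (t + h) - G j t\<bar> \<le> M * \<bar>t + h - t\<bar>"
    proof (rule abs_diff_le_half_line[where S = "{t..t + h}" and g' = "G (Suc j)"])
      show "(G j has_real_derivative G (Suc j) t) (at t within {0..})" if "t \<ge> 0" for t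
        using Suc.prems(1) that by simp
      show "\<bar>G (Suc j) u\<bar> \<le> M" if "u \<in> {t..t + h}" for u
        using Suc.prems(2) sub that by blast
    qed (use h \<open>t \<ge> 0\<close> in auto)
    then show "\<bar>H j t\<bar> \<le> M * h" using h by (simp add: H_def)
  qed
  moreover have "(\<lambda>k. H 0 (real k * h)) = fdiff (\<lambda>k. G 0 (real k * h))"
    by (simp add: H_def fdiff_def fun_eq_iff algebra_simps)
  ultimately show ?case by (simp add: funpow_swap1 mult_ac)
qed

text \<open>Descending induction from order m: each application of the mean value bound on the
  segment between \<open>x\<close> and \<open>t\<close> gains a factor |t - x|. Factorials are
  dropped since only the order matters.\<close>

lemma taylor_remainder_bound:
  fixes G :: "nat \<Rightarrow> real \<Rightarrow> real"
  assumes deriv: "\<And>i t. i < m \<Longrightarrow> t \<ge> 0 \<Longrightarrow> (G i has_real_derivative G (Suc i) t) (at t within {0..})"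
    and zero: "\<And>i. i < m \<Longrightarrow> G i x = 0"
    and K: "\<And>t. t \<ge> 0 \<Longrightarrow> \<bar>G m t\<bar> \<le> K"
    and x: "x \<ge> 0" and i: "i \<le> m" and t: "t \<ge> 0"
  shows "\<bar>G i t\<bar> \<le> K * \<bar>t - x\<bar> ^ (m - i)"
  using i t
proof (induction i arbitrary: t rule: inc_induct)
  case base
  then show ?case using K by simp
next
  case (step i)
  define S where "S = closed_segment x t"
  have S: "S \<subseteq> {0..}" using x step.prems by (auto simp: S_def closed_segment_eq_real_ivl split: if_splits)
  have dist: "\<bar>u - x\<bar> \<le> \<bar>t - x\<bar>" if "u \<in> S" for u
    using that by (auto simp: S_def closed_segment_eq_real_ivl split: if_splits)
  have "K \<ge> 0" using K[OF x] by linarith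
  have "\<bar>G i t - G i x\<bar> \<le> (K * \<bar>t - x\<bar> ^ (m - Suc i)) * \<bar>t - x\<bar>"
  proof (rule abs_diff_le_half_line[where S = S and g' = "G (Suc i)"])
    show "\<bar>G (Suc i) u\<bar> \<le> K * \<bar>t - x\<bar> ^ (m - Suc i)" if "u \<in> S" for u
    proof -
      have "\<bar>G (Suc i) u\<bar> \<le> K * \<bar>u - x\<bar> ^ (m - Suc i)"
        using step.IH S that by auto
      also have "\<dots> \<le> K * \<bar>t - x\<bar> ^ (m - Suc i)"
        using \<open>K \<ge> 0\<close> dist[OF that] by (intro mult_left_mono power_mono) auto
      finally show ?thesis .
    qed
  qed (use deriv step S in \<open>auto simp: S_def\<close>)
  also have "\<dots> = K * \<bar>t - x\<bar> ^ (m - i)"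
    using step.hyps by (simp add: Suc_diff_Suc flip: power_Suc2)
  finally show ?case using zero step.hyps by simp
qed

lemma pochhammer_le_power: "pochhammer (real n) j \<le> (real n + real j) ^ j"
proof -
  have "pochhammer (real n) j \<le> (\<Prod>i<j. real n + real j)"
    unfolding pochhammer_prod lessThan_atLeast0 by (intro prod_mono) auto
  then show ?thesis by simp
qed

text \<open>The bound is uniform in \<open>n\<close>: the \<open>j\<close>-th finite difference supplies a factor \<open>n ^ (-j)\<close>
  compensating the Pochhammer symbol, and the moments contribute \<open>n ^ (-(m - j) / 2)\<close>.\<close>

lemma baskakov_remainder_bound:
  fixes G :: "nat \<Rightarrow> real \<Rightarrow> real"
  assumes deriv: "\<And>i t. i < m \<Longrightarrow> t \<ge> 0 \<Longrightarrow> (G i has_real_derivative G (Suc i) t) (at t within {0..})"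
    and zero: "\<And>i. i < m \<Longrightarrow> G i x = 0"
    and K: "\<And>t. t \<ge> 0 \<Longrightarrow> \<bar>G m t\<bar> \<le> K"
    and x: "x \<ge> 0" and j: "j \<le> m"
    and growth: "\<And>n. poly_growth (\<lambda>k. G 0 (real k / real n))"
  shows "\<exists>C\<ge>0. \<forall>n>0. 16 * x\<^sup>2 \<le> real n \<longrightarrow>
     \<bar>pochhammer (real n) j * bsum (n + j) ((fdiff ^^ j) (\<lambda>k. G 0 (real k / real n))) x\<bar>
       * sqrt (real n) ^ (m - j) \<le> C"
proof -
  define p where "p = m - j"
  obtain C where C: "bsum (n + j) (\<lambda>k. \<bar>real k / real n - x\<bar> ^ p) x * sqrt (real n) ^ p \<le> C"
    if "n > 0" "16 * x\<^sup>2 \<le> real n" for n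
    using baskakov_moment_bound[OF x, of j p] by blast
  have "K \<ge> 0" using K[OF x] by linarith
  \<comment> \<open>(1 + j)^j comes from the Pochhammer symbol, 2^p from splitting (u + v)^p,
    \<open>C\<close> from the moments, and j^p from the displacement by up to j nodes.\<close>
  define C' where "C' = (1 + real j) ^ j * (K * 2 ^ p * (\<bar>C\<bar> + real j ^ p))"
  have "\<bar>pochhammer (real n) j * bsum (n + j) ((fdiff ^^ j) (\<lambda>k. G 0 (real k / real n))) x\<bar>
       * sqrt (real n) ^ p \<le> C'" if n: "n > 0" "16 * x\<^sup>2 \<le> real n" for n
  proof -
    define s where "s = sqrt (real n)"
    have s: "s > 0" "s \<ge> 1" using n by (simp_all add: s_def)
    have "s * 1 \<le> s * s" using s by (intro mult_left_mono) auto
    then have s_le: "s \<le> real n" by (simp add: s_def)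
    define a where "a = (fdiff ^^ j) (\<lambda>k. G 0 (real k / real n))"
    define L where "L = (1 / real n) ^ j * (K * 2 ^ p)"
    define b where "b = (\<lambda>k. \<bar>real k / real n - x\<bar> ^ p)"
    have b: "poly_growth b" unfolding b_def
      by (intro poly_growth_power poly_growth_abs poly_growth_diff poly_growth_divide
          poly_growth_of_nat poly_growth_const)
    \<comment> \<open>The j-th difference at k only involves points between k/n and (k + j)/n, whose
      distance from x is at most u + v.\<close>
    have ab: "\<bar>a k\<bar> \<le> L * b k + L * (real j / real n) ^ p" for k
    proof -
      define u where "u = \<bar>real k / real n - x\<bar>"
      define v where "v = real j / real n"
      have uv: "u \<ge> 0" "v \<ge> 0" by (simp_all add: u_def v_def)
      have pow_le: "(u + v) ^ p \<le> 2 ^ p * (u ^ p + v ^ p)"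
      proof -
        have "(u + v) ^ p \<le> (2 * max u v) ^ p" using uv by (intro power_mono) auto
        also have "\<dots> = 2 ^ p * (max u v) ^ p" by (simp add: power_mult_distrib)
        also have "\<dots> \<le> 2 ^ p * (u ^ p + v ^ p)"
          using uv by (intro mult_left_mono) (auto simp: max_def)
        finally show ?thesis .
      qed
      have "\<bar>(fdiff ^^ j) (\<lambda>k. G 0 (real k * (1 / real n))) k\<bar> \<le> (1 / real n) ^ j * (K * (u + v) ^ p)"
      proof (rule fdiff_power_bound)
        fix t assume t: "t \<in> {real k * (1 / real n)..real (k + j) * (1 / real n)}"
        then have "\<bar>t - x\<bar> \<le> u + v" "t \<ge> 0"
          by (auto simp: u_def v_def add_divide_distrib intro: order.trans[rotated])
        have "\<bar>G j t\<bar> \<le> K * \<bar>t - x\<bar> ^ p"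
          unfolding p_def using taylor_remainder_bound[OF deriv zero K x j \<open>t \<ge> 0\<close>] by blast
        also have "\<dots> \<le> K * (u + v) ^ p"
          using \<open>K \<ge> 0\<close> \<open>\<bar>t - x\<bar> \<le> u + v\<close> by (intro mult_left_mono power_mono) auto
        finally show "\<bar>G j t\<bar> \<le> K * (u + v) ^ p" .
      qed (use deriv j in auto)
      also have "(1 / real n) ^ j * (K * (u + v) ^ p) \<le> (1 / real n) ^ j * (K * (2 ^ p * (u ^ p + v ^ p)))"
        using \<open>K \<ge> 0\<close> pow_le by (intro mult_left_mono) auto
      finally show ?thesis by (simp add: a_def L_def b_def u_def v_def algebra_simps)
    qed
    have "\<bar>bsum (n + j) a x\<bar> \<le> bsum (n + j) (\<lambda>k. L * b k + L * (real j / real n) ^ p) x"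
      unfolding a_def
      by (intro abs_bsum_le poly_growth_fdiff_power growth poly_growth_add poly_growth_mult
          poly_growth_const b x ab[unfolded a_def])
    also have "\<dots> = L * bsum (n + j) b x + L * (real j / real n) ^ p"
      using n x b by (simp add: bsum_add[OF poly_growth_mult[OF poly_growth_const b] poly_growth_const]
          bsum_cmult bsum_const)
    finally have "\<bar>bsum (n + j) a x\<bar> * s ^ p \<le> (L * bsum (n + j) b x + L * (real j / real n) ^ p) * s ^ p"
      using s by (intro mult_right_mono) auto
    also have "\<dots> = L * (bsum (n + j) b x * s ^ p + (real j / real n * s) ^ p)"
      unfolding power_mult_distrib by (simp only: distrib_right distrib_left mult_ac)
    also have "\<dots> \<le> L * (\<bar>C\<bar> + real j ^ p)"
    proof (intro mult_left_mono add_mono power_mono)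
      show "bsum (n + j) b x * s ^ p \<le> \<bar>C\<bar>"
        using C[OF n] by (simp add: b_def s_def)
      \<comment> \<open>A shift of j/n remains bounded after scaling by sqrt n, which is at most
        n.\<close>
      show "real j / real n * s \<le> real j"
        using mult_left_mono[OF s_le, of "real j"] n(1) by (simp add: field_simps)
    qed (use s \<open>K \<ge> 0\<close> in \<open>auto simp: L_def\<close>)
    finally have 1: "\<bar>bsum (n + j) a x\<bar> * s ^ p \<le> L * (\<bar>C\<bar> + real j ^ p)" .
    have "pochhammer (real n) j \<le> (real n + real j) ^ j" by (rule pochhammer_le_power)
    also have "\<dots> \<le> (real n * (1 + real j)) ^ j"
    proof (rule power_mono)
      have "1 * real j \<le> real n * real j" using n(1) by (intro mult_right_mono) auto
      then show "real n + real j \<le> real n * (1 + real j)" by (simp add: algebra_simps)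
    qed simp
    finally have 2: "pochhammer (real n) j \<le> (real n * (1 + real j)) ^ j" .
    have 3: "pochhammer (real n) j \<ge> 0"
      using n(1) by (intro pochhammer_nonneg) auto
    have "\<bar>pochhammer (real n) j * bsum (n + j) a x\<bar> * s ^ p
       = pochhammer (real n) j * (\<bar>bsum (n + j) a x\<bar> * s ^ p)"
      using 3 by (simp add: abs_mult)
    also have "\<dots> \<le> (real n * (1 + real j)) ^ j * (L * (\<bar>C\<bar> + real j ^ p))"
      using s by (intro mult_mono 1 2) auto
    also have "\<dots> = C'"
      using n(1) by (simp add: C'_def L_def power_mult_distrib power_divide)
    finally show ?thesis by (simp add: a_def s_def)
  qed
  moreover have "C' \<ge> 0" using \<open>K \<ge> 0\<close> by (simp add: C'_def)
  ultimately show ?thesis unfolding p_def by blast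
qed

section \<open>The asymptotic expansion\<close>

text \<open>Derivatives within the half-line are unique, so any family of successive derivatives
  computes the iterates of \<open>D\<close>; values at negative arguments never enter.\<close>

lemma higher_D_eq:
  assumes deriv: "\<And>i t. i < k \<Longrightarrow> t \<ge> 0 \<Longrightarrow> (H i has_real_derivative H (Suc i) t) (at t within {0..})"
    and f: "\<And>t. t \<ge> 0 \<Longrightarrow> f t = H 0 t" and t: "t \<ge> 0"
  shows "(D ^^ k) f t = H k t"
  using deriv t
proof (induction k arbitrary: t)
  case 0
  then show ?case by (simp add: f)
next
  case (Suc k)
  have "(H k has_real_derivative H (Suc k) t) (at t within {0..})"
    using Suc.prems by simp
  then have "((D ^^ k) f has_real_derivative H (Suc k) t) (at t within {0..})"
    by (rule has_field_derivative_transform_within[where d = 1])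
      (use Suc.prems(2) Suc.IH[OF Suc.prems(1)] in auto)
  then show ?case
    unfolding has_real_derivative_iff_has_vector_derivative
    by (simp add: D_def[of "(D ^^ k) f"] vector_derivative_within at_half_line_neq_bot Suc.prems(2))
qed

lemma C_half_line_derivative:
  assumes "f \<in> C_half_line m" "k < m" "t \<ge> 0"
  shows "((D ^^ k) f has_real_derivative (D ^^ Suc k) f t) (at t within {0..})"
proof -
  have "(D ^^ k) f differentiable (at t within {0..})"
    using assms by (auto simp: C_half_line_def differentiable_on_def)
  then have "((D ^^ k) f has_vector_derivative (D ^^ Suc k) f t) (at t within {0..})"
    by (simp add: D_def vector_derivative_works)
  then show ?thesis
    by (simp only: has_real_derivative_iff_has_vector_derivative)
qed

lemma higher_pderiv_pcompose_shift:
  "(pderiv ^^ k) (pcompose p [:- x, 1:]) = pcompose ((pderiv ^^ k) p) [:- x, 1:]"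
  for p :: "real poly"
  by (induction k) (simp_all add: pderiv_pcompose pderiv_pCons)

text \<open>The Taylor polynomial with prescribed derivatives at \<open>x\<close>, obtained by
  composing with t - x.\<close>

lemma taylor_poly_exists:
  fixes c :: "nat \<Rightarrow> real"
  shows "\<exists>P. degree P \<le> m \<and> (\<forall>i\<le>m. poly ((pderiv ^^ i) P) x = c i)"
proof (intro exI conjI allI impI)
  define Q where "Q = (\<Sum>i\<le>m. monom (c i / fact i) i)"
  have "degree Q \<le> m"
    unfolding Q_def by (intro degree_sum_le) (auto intro: order.trans[OF degree_monom_le])
  then show "degree (pcompose Q [:- x, 1:]) \<le> m"
    by (simp add: degree_pcompose)
  fix i assume i: "i \<le> m"
  then have "coeff Q i = c i / fact i"
    by (simp add: Q_def coeff_sum sum.delta)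
  then show "poly ((pderiv ^^ i) (pcompose Q [:- x, 1:])) x = c i"
    by (simp add: higher_pderiv_pcompose_shift poly_pcompose poly_0_coeff_0 coeff_higher_pderiv
        pochhammer_fact[symmetric])
qed

text \<open>Convergent sequences are bounded. For odd j the true order is n^(-(j+1)/2), which for n
  at least 1 is more than required.\<close>

lemma eta_bound:
  fixes x :: real
  shows "\<exists>C\<ge>0. \<forall>n>0. \<bar>poly (eta n j) x\<bar> * sqrt (real n) ^ j \<le> C"
proof -
  have bound: "\<exists>C\<ge>0. \<forall>n. \<bar>X n\<bar> \<le> C" if "X \<longlonglongrightarrow> L" for X :: "nat \<Rightarrow> real" and L
  proof -
    from that have "Bseq X" by (auto intro: convergent_imp_Bseq convergentI)
    then obtain C where "C > 0" "\<And>n. norm (X n) \<le> C" by (auto elim: BseqE)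
    then show ?thesis by (intro exI[of _ C]) auto
  qed
  show ?thesis
  proof (cases "even j")
    case True
    then obtain l where j: "j = 2 * l" by blast
    obtain C where C: "C \<ge> 0" "\<And>n. \<bar>real n ^ l * poly (eta n (2 * l)) x\<bar> \<le> C"
      using bound[OF eta_tendsto(1)[of l x]] by blast
    have "\<bar>poly (eta n j) x\<bar> * sqrt (real n) ^ j \<le> C" for n
    proof -
      have "sqrt (real n) ^ j = real n ^ l" unfolding j power_mult by simp
      then show ?thesis using C(2)[of n] by (simp add: j abs_mult mult.commute)
    qed
    with C(1) show ?thesis by blast
  next
    case False
    then obtain l where j: "j = 2 * l + 1" by (auto elim: oddE)
    obtain C where C: "C \<ge> 0" "\<And>n. \<bar>real n ^ (l + 1) * poly (eta n (2 * l + 1)) x\<bar> \<le> C"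
      using bound[OF eta_tendsto(2)[of l x]] by blast
    have "\<bar>poly (eta n j) x\<bar> * sqrt (real n) ^ j \<le> C" if "n > 0" for n
    proof -
      have "sqrt (real n) ^ j \<le> sqrt (real n) ^ (2 * (l + 1))"
        using that by (intro power_increasing) (auto simp: j)
      also have "\<dots> = real n ^ (l + 1)" unfolding power_mult by simp
      finally have "\<bar>poly (eta n j) x\<bar> * sqrt (real n) ^ j \<le> \<bar>poly (eta n j) x\<bar> * real n ^ (l + 1)"
        by (intro mult_left_mono) auto
      also have "\<dots> \<le> C" using C(2)[of n] by (simp add: j abs_mult mult.commute)
      finally show ?thesis .
    qed
    with C(1) show ?thesis by blast
  qed
qed

text \<open>Up to a vanishing error, only the terms of the polynomial part with index above
  \<open>s\<close> survive.\<close>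

lemma baskakov_quasi_expansion:
  fixes f :: "real \<Rightarrow> real"
  assumes f: "f \<in> C_half_line (2 * r + 4)"
    and bdd: "bounded ((D ^^ (2 * r + 4)) f ` {0..})"
    and x: "x \<ge> 0" and s: "s \<le> 2 * r + 1"
    and P: "degree P \<le> 2 * r + 3" "\<And>i. i \<le> 2 * r + 3 \<Longrightarrow> poly ((pderiv ^^ i) P) x = (D ^^ i) f x"
  shows "(\<lambda>n. real n ^ (r + 1) * (f x - baskakov_quasi s n f x) -
     (\<Sum>k\<in>{s<..<2 * r + 4}. real n ^ (r + 1) * poly (eta n k) x * poly ((pderiv ^^ k) (baskakov_rec n P)) x))
     \<longlonglongrightarrow> 0"
proof -
  define m where "m = 2 * r + 4"
  define G where "G = (\<lambda>i t. (D ^^ i) f t - poly ((pderiv ^^ i) P) t)"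
  have poly_deriv: "(poly ((pderiv ^^ i) p) has_real_derivative poly ((pderiv ^^ Suc i) p) t) (at t within A)"
    for p i t A using poly_DERIV[of "(pderiv ^^ i) p" t] by (simp add: has_field_derivative_at_within)
  have deriv: "(G i has_real_derivative G (Suc i) t) (at t within {0..})" if "i < m" "t \<ge> 0" for i t
    unfolding G_def
    by (intro DERIV_diff C_half_line_derivative[OF f] poly_deriv) (use that in \<open>simp_all add: m_def\<close>)
  have zero: "G i x = 0" if "i < m" for i
    using P(2)[of i] that by (simp add: G_def m_def)
  obtain K where K: "\<bar>G m t\<bar> \<le> K" if "t \<ge> 0" for t
  proof -
    have "(pderiv ^^ m) P = 0"
      using P(1) by (intro higher_pderiv_eq_0) (simp add: m_def)
    moreover obtain K where "\<And>t. t \<ge> 0 \<Longrightarrow> \<bar>(D ^^ m) f t\<bar> \<le> K"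
      using bdd by (auto simp: bounded_iff m_def)
    ultimately show ?thesis by (intro that[of K]) (simp add: G_def)
  qed
  have growth: "poly_growth (\<lambda>k. G 0 (real k / real n))" for n
  proof (rule poly_growth_mono)
    show "poly_growth (\<lambda>k. K * \<bar>real k / real n - x\<bar> ^ m)"
      by (intro poly_growth_mult poly_growth_power poly_growth_abs poly_growth_diff
          poly_growth_divide poly_growth_of_nat poly_growth_const)
    show "\<bar>G 0 (real k / real n)\<bar> \<le> \<bar>K * \<bar>real k / real n - x\<bar> ^ m\<bar>" for k
      using taylor_remainder_bound[of m G x K 0 "real k / real n"] deriv zero K x
      by fastforce
  qed
  define R where "R = (\<lambda>n j. pochhammer (real n) j *
      bsum (n + j) ((fdiff ^^ j) (\<lambda>k. G 0 (real k / real n))) x)"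
  define q where "q = (\<lambda>n k. poly ((pderiv ^^ k) (baskakov_rec n P)) x)"
  have D_eq: "(D ^^ j) (baskakov n f) x = q n j + R n j" if n: "n > 0" for n j
  \<comment> \<open>Each derivative of the remainder series contributes a factor n + i and one
    difference, which produces the Pochhammer symbol.\<close>
  proof -
    define a where "a = (\<lambda>k. G 0 (real k / real n))"
    define H where "H = (\<lambda>i t. poly ((pderiv ^^ i) (baskakov_rec n P)) t
        + pochhammer (real n) i * bsum (n + i) ((fdiff ^^ i) a) t)"
    have a: "poly_growth a" unfolding a_def by (rule growth)
    have "(D ^^ j) (baskakov n f) x = H j x"
    proof (rule higher_D_eq)
      fix i :: nat and t :: real assume t: "t \<ge> 0"
      have "((\<lambda>t. pochhammer (real n) i * bsum (n + i) ((fdiff ^^ i) a) t) has_real_derivative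
        pochhammer (real n) i * (real (n + i) * bsum (Suc (n + i)) (fdiff ((fdiff ^^ i) a)) t)) (at t within {0..})"
        using n t by (intro DERIV_cmult has_real_derivative_bsum poly_growth_fdiff_power a) auto
      then show "(H i has_real_derivative H (Suc i) t) (at t within {0..})"
        unfolding H_def by (intro DERIV_add poly_deriv) (simp add: pochhammer_Suc mult.assoc)
    next
      fix t :: real assume t: "t \<ge> 0"
      have "poly_growth (\<lambda>k. poly P (real k / real n))"
        by (intro poly_growth_poly poly_growth_divide poly_growth_of_nat)
      from bsum_add[OF this a t, of n]
      have "baskakov n f t = baskakov n (poly P) t + bsum n a t"
        by (simp add: baskakov_eq_bsum a_def G_def)
      then show "baskakov n f t = H 0 t"
        by (simp add: H_def baskakov_poly_eq_rec t n)
    qed (rule x)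
    then show ?thesis by (simp add: H_def R_def q_def a_def)
  qed
  have expand: "f x - baskakov_quasi s n f x =
      (\<Sum>k\<in>{s<..<m}. poly (eta n k) x * q n k) - (\<Sum>k\<le>s. poly (eta n k) x * R n k)" if n: "n > 0" for n
  proof -
    \<comment> \<open>The inverse applied to the image of \<open>P\<close> returns \<open>P\<close>;
      splitting that finite sum at \<open>s\<close> and subtracting the quasi-interpolant leaves the
      tail and the remainder terms.\<close>
    have "f x = poly P x" using P(2)[of 0] by simp
    also have "\<dots> = poly (eta_op n (baskakov_rec n P)) x"
      by (simp add: eta_op_baskakov_rec n)
    also have "\<dots> = (\<Sum>k\<le>2 * r + 3. poly (eta n k) x * q n k)"
      using degree_baskakov_rec[of n P] P(1)
      by (subst eta_op_eq_sum[where N = "2 * r + 3"]) (auto simp: poly_sum q_def)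
    also have "{..2 * r + 3} = {..s} \<union> {s<..<m}"
      using s by (auto simp: m_def)
    also have "(\<Sum>k\<in>{..s} \<union> {s<..<m}. poly (eta n k) x * q n k) =
        (\<Sum>k\<le>s. poly (eta n k) x * q n k) + (\<Sum>k\<in>{s<..<m}. poly (eta n k) x * q n k)"
      by (intro sum.union_disjoint) auto
    finally show ?thesis
      by (simp add: baskakov_quasi_def baskakov_eta_eq n D_eq distrib_left sum.distrib)
  qed
  \<comment> \<open>The orders add up to n^(r+1) n^(-j/2) n^(-(m-j)/2) = 1/n, because m = 2r +
    4.\<close>
  have null: "(\<lambda>n. real n ^ (r + 1) * (poly (eta n j) x * R n j)) \<longlonglongrightarrow> 0" if j: "j \<le> s" for j
  proof -
    have jm: "j \<le> m" using j s by (simp add: m_def)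
    obtain C1 where C1: "C1 \<ge> 0" "\<And>n. n > 0 \<Longrightarrow> \<bar>poly (eta n j) x\<bar> * sqrt (real n) ^ j \<le> C1"
      using eta_bound by blast
    obtain C2 where C2: "C2 \<ge> 0"
      "\<And>n. n > 0 \<Longrightarrow> 16 * x\<^sup>2 \<le> real n \<Longrightarrow> \<bar>R n j\<bar> * sqrt (real n) ^ (m - j) \<le> C2"
      using baskakov_remainder_bound[OF deriv zero K x jm growth] unfolding R_def by blast
    show ?thesis
    proof (rule Lim_null_comparison)
      have "\<forall>\<^sub>F n in sequentially. 16 * x\<^sup>2 \<le> real n"
        using filterlim_real_sequentially by (auto simp: filterlim_at_top)
      then show "\<forall>\<^sub>F n in sequentially. norm (real n ^ (r + 1) * (poly (eta n j) x * R n j)) \<le> C1 * C2 * (1 / real n)"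
        using eventually_gt_at_top[of 0]
      proof eventually_elim
        case (elim n)
        have "real n ^ (r + 1) * real n = sqrt (real n) ^ m"
        proof -
          have "m = 2 * (r + 2)" by (simp add: m_def)
          then have "sqrt (real n) ^ m = (sqrt (real n) ^ 2) ^ (r + 2)"
            by (simp only: power_mult)
          then show ?thesis by simp
        qed
        also have "\<dots> = sqrt (real n) ^ j * sqrt (real n) ^ (m - j)"
          using jm by (simp flip: power_add)
        finally have "norm (real n ^ (r + 1) * (poly (eta n j) x * R n j)) * real n =
          (\<bar>poly (eta n j) x\<bar> * sqrt (real n) ^ j) * (\<bar>R n j\<bar> * sqrt (real n) ^ (m - j))"
          by (simp add: abs_mult algebra_simps)
        also have "\<dots> \<le> C1 * C2"
          using elim C1 C2 by (intro mult_mono) auto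
        finally show ?case using elim by (simp add: field_simps)
      qed
      show "(\<lambda>n. C1 * C2 * (1 / real n)) \<longlonglongrightarrow> 0"
        by (intro tendsto_mult_right_zero lim_1_over_n)
    qed
  qed
  have "(\<lambda>n. - (\<Sum>k\<le>s. real n ^ (r + 1) * (poly (eta n k) x * R n k))) \<longlonglongrightarrow> - 0"
    by (intro tendsto_minus tendsto_null_sum null) simp
  then have "(\<lambda>n. - (\<Sum>k\<le>s. real n ^ (r + 1) * (poly (eta n k) x * R n k))) \<longlonglongrightarrow> 0"
    by simp
  then show ?thesis
  proof (rule Lim_transform_eventually)
    show "\<forall>\<^sub>F n in sequentially. - (\<Sum>k\<le>s. real n ^ (r + 1) * (poly (eta n k) x * R n k)) =
      real n ^ (r + 1) * (f x - baskakov_quasi s n f x) -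
      (\<Sum>k\<in>{s<..<2 * r + 4}. real n ^ (r + 1) * poly (eta n k) x * poly ((pderiv ^^ k) (baskakov_rec n P)) x)"
      using eventually_gt_at_top[of 0]
      by eventually_elim
        (simp add: expand right_diff_distrib sum_distrib_left mult.assoc q_def flip: m_def)
  qed
qed

theorem theorem5:
  fixes r :: nat and f :: "real \<Rightarrow> real" and x :: real
  assumes "f \<in> C_half_line (2 * r + 4)"
    and "bounded ((D ^^ (2 * r + 4)) f ` {0..})"
    and "x \<ge> 0"
  shows "((\<lambda>n. real n ^ (r + 1) * (f x - baskakov_quasi (2 * r) n f x)) \<longlonglongrightarrow>
            eta_bar_odd r x * (D ^^ (2 * r + 1)) f x + eta_bar_even r x * (D ^^ (2 * r + 2)) f x) \<and>
         ((\<lambda>n. real n ^ (r + 1) * (f x - baskakov_quasi (2 * r + 1) n f x)) \<longlonglongrightarrow>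
            eta_bar_even r x * (D ^^ (2 * r + 2)) f x)"
proof -
  obtain P where P: "degree P \<le> 2 * r + 3"
    "\<And>i. i \<le> 2 * r + 3 \<Longrightarrow> poly ((pderiv ^^ i) P) x = (D ^^ i) f x"
    using taylor_poly_exists[of "2 * r + 3" x "\<lambda>i. (D ^^ i) f x"] by blast
  define T where "T = (\<lambda>k n. real n ^ (r + 1) * poly (eta n k) x * poly ((pderiv ^^ k) (baskakov_rec n P)) x)"
  have lim: "T k \<longlonglongrightarrow> e * (D ^^ k) f x"
    if "(\<lambda>n. real n ^ (r + 1) * poly (eta n k) x) \<longlonglongrightarrow> e" "k \<le> 2 * r + 3" for k e
    unfolding T_def P(2)[OF that(2), symmetric]
    by (intro tendsto_mult that(1) baskakov_rec_tendsto)
  have odd: "T (2 * r + 1) \<longlonglongrightarrow> eta_bar_odd r x * (D ^^ (2 * r + 1)) f x"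
    by (intro lim eta_tendsto) simp
  have "(\<lambda>n. real n ^ (r + 1) * poly (eta n (2 * (r + 1))) x) \<longlonglongrightarrow> eta_bar_even r x"
    using eta_tendsto(1)[of "r + 1" x] by (simp only: eta_bar_even_def)
  moreover have "2 * (r + 1) = 2 * r + 2" by simp
  ultimately have even: "T (2 * r + 2) \<longlonglongrightarrow> eta_bar_even r x * (D ^^ (2 * r + 2)) f x"
    by (intro lim) simp_all
  \<comment> \<open>The coefficient of index 2r + 3 has order n^(-(r+2)), one power better than the
    scaling, so its term disappears.\<close>
  have "(\<lambda>n. 1 / real n * (real n ^ (r + 1 + 1) * poly (eta n (2 * (r + 1) + 1)) x))
      \<longlonglongrightarrow> 0 * eta_bar_odd (r + 1) x"
    by (intro tendsto_mult lim_1_over_n eta_tendsto)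
  then have "(\<lambda>n. real n ^ (r + 1) * poly (eta n (2 * (r + 1) + 1)) x) \<longlonglongrightarrow> 0 * eta_bar_odd (r + 1) x"
    by (rule Lim_transform_eventually)
      (use eventually_gt_at_top[of 0] in \<open>eventually_elim, simp\<close>)
  moreover have *: "2 * (r + 1) + 1 = 2 * r + 3" by simp
  ultimately have "T (2 * r + 3) \<longlonglongrightarrow> 0 * eta_bar_odd (r + 1) x * (D ^^ (2 * r + 3)) f x"
    unfolding * by (intro lim) simp_all
  then have rest: "T (2 * r + 3) \<longlonglongrightarrow> 0" by simp
  have expansion: "(\<lambda>n. real n ^ (r + 1) * (f x - baskakov_quasi s n f x)) \<longlonglongrightarrow> L"
    if "s \<le> 2 * r + 1" "(\<lambda>n. \<Sum>k\<in>{s<..<2 * r + 4}. T k n) \<longlonglongrightarrow> L" for s L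
    using tendsto_add[OF baskakov_quasi_expansion[OF assms that(1) P] that(2)]
    by (simp add: T_def)
  \<comment> \<open>Order 2r leaves the indices 2r + 1, 2r + 2 and 2r + 3; order 2r + 1 leaves only
    the last two.\<close>
  have "(\<lambda>n. T (2 * r + 1) n + (T (2 * r + 2) n + T (2 * r + 3) n)) \<longlonglongrightarrow>
     eta_bar_odd r x * (D ^^ (2 * r + 1)) f x + (eta_bar_even r x * (D ^^ (2 * r + 2)) f x + 0)"
    by (intro tendsto_add odd even rest)
  moreover have "{2 * r<..<2 * r + 4} = {2 * r + 1, 2 * r + 2, 2 * r + 3}" by auto
  moreover have "(\<lambda>n. T (2 * r + 2) n + T (2 * r + 3) n) \<longlonglongrightarrow>
     eta_bar_even r x * (D ^^ (2 * r + 2)) f x + 0"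
    by (intro tendsto_add even rest)
  moreover have "{2 * r + 1<..<2 * r + 4} = {2 * r + 2, 2 * r + 3}" by auto
  ultimately show ?thesis by (intro conjI expansion) (simp_all del: One_nat_def)
qed

end
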